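(* Let $\{D_\lambda\}_{\lambda\in\mathbb{N}}$ be a family of distributions over pairs $(x,y)$ of classical bit strings, and suppose there exist families of distributions $\{E_\lambda\}_{\lambda}$ (over strings $x$) and $\{F_\lambda\}_{\lambda}$ (over strings $y$) such that $\|D_\lambda-E_\lambda\times F_\lambda\|_1<\frac{5-2\sqrt2}{17}$, i.e., $\sum_{x,y}|\Pr_{D_\lambda}[(x,y)]-\Pr_{E_\lambda}[x]\Pr_{F_\lambda}[y]|<\frac{5-2\sqrt2}{17}$. Then there is no (non-interactive) commitment scheme in the correlated randomness model with $\{D_\lambda\}$ that is simultaneously statistically hiding and statistically (sum-)binding.
   Context: A (non-interactive) commitment scheme in the correlated randomness model with $\{D_\lambda\}$ consists of uniform QPT algorithms $\mathsf{Setup}$, $C$, $R$. Setup: $\mathsf{Setup}(1^\lambda)$ samples $(x,y)\gets D_\lambda$, sends $x$ to $C$ and $y$ to $R$. Commit: $C$ on input $x$ and a bit $b$ generates a quantum state $\ket{\Psi_{x,b}}$ on registers $\mathbf{C},\mathbf{R}$ and sends $\mathbf{C}$ to $R$. Reveal: $C$ sends $b$ and $\mathbf{R}$; $R$ applies a POVM $\{\Lambda_{y,b},I-\Lambda_{y,b}\}$ to $(\mathbf{C},\mathbf{R})$ and outputs $b$ on outcome $\Lambda_{y,b}$, else $\bot$. Correctness: honest runs are accepted with probability 1. Statistical hiding: every unbounded adversary given $y$ and register $\mathbf{C}$ of an honest commitment distinguishes $b=0$ from $b=1$ with advantage $\mathsf{negl}(\lambda)$. Statistical sum-binding: for any pair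 of unbounded malicious committers $C_0^*,C_1^*$ that receive $x$ and act identically in the commit phase, letting $p_b$ be the probability that $R$ accepts the revealed bit $b$ from $C_b^*$, $p_0+p_1\le1+\mathsf{negl}(\lambda)$. *)

theory Defs
  imports "Jordan_Normal_Form.Schur_Decomposition" "HOL-Probability.Probability_Mass_Function"
begin

text \<open>Inner product convention: v \<bullet>c w = sum_i v_i * cnj (w_i), i.e. the bra-ket <w|v>.\<close>

definition qstate :: "nat \<Rightarrow> complex Matrix.vec \<Rightarrow> bool" where
  "qstate d v \<longleftrightarrow> v \<in> carrier_vec d \<and> v \<bullet>c v = 1"

definition psd :: "nat \<Rightarrow> complex mat \<Rightarrow> bool" where
  "psd d M \<longleftrightarrow> M \<in> carrier_mat d d \<and>
     (\<forall>v \<in> carrier_vec d. (M *\<^sub>v v) \<bullet>c v \<in> \<real> \<and> 0 \<le> Re ((M *\<^sub>v v) \<bullet>c v))"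

definition povm_elem :: "nat \<Rightarrow> complex mat \<Rightarrow> bool" where
  "povm_elem d M \<longleftrightarrow> psd d M \<and> psd d (1\<^sub>m d - M)"

definition unitary_mat :: "nat \<Rightarrow> complex mat \<Rightarrow> bool" where
  "unitary_mat d U \<longleftrightarrow> U \<in> carrier_mat d d \<and> mat_adjoint U * U = 1\<^sub>m d"

definition kron :: "complex mat \<Rightarrow> complex mat \<Rightarrow> complex mat" where
  "kron A B = Matrix.mat (dim_row A * dim_row B) (dim_col A * dim_col B)
     (\<lambda>(i, j). A $$ (i div dim_row B, j div dim_col B) * B $$ (i mod dim_row B, j mod dim_col B))"

definition acc_prob :: "complex mat \<Rightarrow> complex Matrix.vec \<Rightarrow> real" where
  "acc_prob M v = Re ((M *\<^sub>v v) \<bullet>c v)"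

definition negligible :: "(nat \<Rightarrow> real) \<Rightarrow> bool" where
  "negligible f \<longleftrightarrow> (\<forall>c::nat. \<exists>N. \<forall>n\<ge>N. \<bar>f n\<bar> \<le> 1 / real n ^ c)"

text \<open>A scheme (for security parameter n) is given by
  dC n, dR n : dimensions of registers C and R,
  Psi n x b  : the honest commitment state on C \<otimes> R (index c * dR n + r),
  Lam n y b  : the receiver's accepting POVM element Lambda_{y,b} on C \<otimes> R.
  D n is the setup distribution over (x, y).\<close>

definition wf_scheme ::
  "(nat \<Rightarrow> nat) \<Rightarrow> (nat \<Rightarrow> nat) \<Rightarrow> (nat \<Rightarrow> bool list \<Rightarrow> bool \<Rightarrow> complex Matrix.vec)
   \<Rightarrow> (nat \<Rightarrow> bool list \<Rightarrow> bool \<Rightarrow> complex mat) \<Rightarrow> bool" where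
  "wf_scheme dC dR Psi Lam \<longleftrightarrow>
     (\<forall>n x b. qstate (dC n * dR n) (Psi n x b)) \<and>
     (\<forall>n y b. povm_elem (dC n * dR n) (Lam n y b))"

definition correct_scheme ::
  "(nat \<Rightarrow> (bool list \<times> bool list) pmf) \<Rightarrow> (nat \<Rightarrow> bool list \<Rightarrow> bool \<Rightarrow> complex Matrix.vec)
   \<Rightarrow> (nat \<Rightarrow> bool list \<Rightarrow> bool \<Rightarrow> complex mat) \<Rightarrow> bool" where
  "correct_scheme D Psi Lam \<longleftrightarrow>
     (\<forall>n b x y. (x, y) \<in> set_pmf (D n) \<longrightarrow> acc_prob (Lam n y b) (Psi n x b) = 1)"

text \<open>Statistical hiding: an unbounded adversary gets y and register C; any such
  distinguisher is a (y-dependent) two-outcome POVM {M, I-M} on C, i.e. M \<otimes> I_R on C \<otimes> R.\<close>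
definition hiding_adv ::
  "(nat \<Rightarrow> (bool list \<times> bool list) pmf) \<Rightarrow> (nat \<Rightarrow> nat) \<Rightarrow> (nat \<Rightarrow> bool list \<Rightarrow> bool \<Rightarrow> complex Matrix.vec)
   \<Rightarrow> (nat \<Rightarrow> bool list \<Rightarrow> complex mat) \<Rightarrow> nat \<Rightarrow> bool \<Rightarrow> real" where
  "hiding_adv D dR Psi M n b =
     measure_pmf.expectation (D n) (\<lambda>(x, y). acc_prob (kron (M n y) (1\<^sub>m (dR n))) (Psi n x b))"

definition stat_hiding ::
  "(nat \<Rightarrow> (bool list \<times> bool list) pmf) \<Rightarrow> (nat \<Rightarrow> nat) \<Rightarrow> (nat \<Rightarrow> nat)
   \<Rightarrow> (nat \<Rightarrow> bool list \<Rightarrow> bool \<Rightarrow> complex Matrix.vec) \<Rightarrow> bool" where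
  "stat_hiding D dC dR Psi \<longleftrightarrow>
     (\<forall>M. (\<forall>n y. povm_elem (dC n) (M n y)) \<longrightarrow>
        negligible (\<lambda>n. \<bar>hiding_adv D dR Psi M n False - hiding_adv D dR Psi M n True\<bar>))"

text \<open>Statistical sum-binding. The two malicious committers act identically in the commit
  phase: on input x they prepare a pure state phi n x on C \<otimes> A, where A = R \<otimes> E
  (dimension dR n * dE n), and send C.  (Mixed states / randomness are covered by
  purification.)  In the reveal phase, C_b^* applies a unitary U n b x to A and sends the
  R part; the receiver measures Lambda_{y,b} \<otimes> I_E.\<close>
definition binding_prob ::
  "(nat \<Rightarrow> (bool list \<times> bool list) pmf) \<Rightarrow> (nat \<Rightarrow> nat) \<Rightarrow> (nat \<Rightarrow> bool list \<Rightarrow> bool \<Rightarrow> complex mat)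
   \<Rightarrow> (nat \<Rightarrow> nat) \<Rightarrow> (nat \<Rightarrow> bool list \<Rightarrow> complex Matrix.vec) \<Rightarrow> (nat \<Rightarrow> bool \<Rightarrow> bool list \<Rightarrow> complex mat)
   \<Rightarrow> nat \<Rightarrow> bool \<Rightarrow> real" where
  "binding_prob D dC Lam dE phi U n b =
     measure_pmf.expectation (D n)
       (\<lambda>(x, y). acc_prob (kron (Lam n y b) (1\<^sub>m (dE n))) (kron (1\<^sub>m (dC n)) (U n b x) *\<^sub>v phi n x))"

definition stat_sum_binding ::
  "(nat \<Rightarrow> (bool list \<times> bool list) pmf) \<Rightarrow> (nat \<Rightarrow> nat) \<Rightarrow> (nat \<Rightarrow> nat)
   \<Rightarrow> (nat \<Rightarrow> bool list \<Rightarrow> bool \<Rightarrow> complex mat) \<Rightarrow> bool" where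
  "stat_sum_binding D dC dR Lam \<longleftrightarrow>
     (\<forall>dE phi U.
        (\<forall>n x. qstate (dC n * (dR n * dE n)) (phi n x)) \<longrightarrow>
        (\<forall>n b x. unitary_mat (dR n * dE n) (U n b x)) \<longrightarrow>
        negligible (\<lambda>n. max 0 (binding_prob D dC Lam dE phi U n False
                               + binding_prob D dC Lam dE phi U n True - 1)))"

end

theory Submission
  imports Defs "Jordan_Normal_Form.Spectral_Radius" "HOL-Probability.Product_PMF"
begin

text \<open>
  The committer ignores \<open>x\<close>, prepares the purification
  \<open>\<Phi>\<^sub>0 = \<Sum>\<^sub>j \<surd>w\<^sub>j \<psi>(z\<^sub>j, 0) \<otimes> |j\<rangle>\<close> of an honest commitment to \<open>0\<close>, where the weights \<open>w\<close>
  on the strings \<open>z\<close> approximate the marginal of \<open>D\<close> on \<open>x\<close>, and keeps the index \<open>j\<close>.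
  Replacing \<open>x\<close> by a fresh independent sample of its marginal changes acceptance probabilities by
  at most \<open>3\<epsilon>\<close>, where \<open>\<epsilon>\<close> is the distance of \<open>D\<close> from the product distribution, so revealing \<open>0\<close>
  honestly succeeds with probability about \<open>1 - 3\<epsilon>\<close>. By hiding, the reduced states of
  \<open>\<Phi>\<^sub>0\<close> and \<open>\<Phi>\<^sub>1\<close> on the commitment register are nearly indistinguishable, so by Uhlmann's theorem
  (via the polar decomposition and the Powers-Stormer inequality) a unitary on the committer's side
  maps \<open>\<Phi>\<^sub>0\<close> close to \<open>\<Phi>\<^sub>1\<close>, and revealing \<open>1\<close> succeeds with about the same probability.
  The sum of the two is about \<open>2 - 6\<epsilon>\<close>, which exceeds \<open>1\<close> by a constant, as
  \<open>(5 - 2\<surd>2)/17 < 1/6\<close>. The weights are finitely supported because the register of the committer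
  must have finite dimension, whereas the support of \<open>D\<close> may be infinite.
\<close>

unbundle no vec_syntax

section \<open>Unitary matrices and the spectral theorem\<close>

lemma mat_adjoint_dim [simp]:
  "dim_row (mat_adjoint A) = dim_col A" "dim_col (mat_adjoint A) = dim_row A"
  unfolding mat_adjoint_def by auto

lemma mat_adjoint_index [simp]:
  fixes A :: "complex mat"
  assumes "i < dim_col A" "j < dim_row A"
  shows "mat_adjoint A $$ (i, j) = cnj (A $$ (j, i))"
  using assms unfolding mat_adjoint_def by (simp add: mat_of_rows_index)

lemma mult_index:
  assumes "i < dim_row A" "j < dim_col B" "dim_col A = dim_row B"
  shows "(A * B) $$ (i, j) = (\<Sum>k<dim_row B. A $$ (i, k) * B $$ (k, j))"
  using assms by (simp add: scalar_prod_def atLeast0LessThan)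

lemma mult_vec_index:
  assumes "i < dim_row A" "dim_col A = dim_vec v"
  shows "(A *\<^sub>v v) $ i = (\<Sum>k<dim_vec v. A $$ (i, k) * v $ k)"
  using assms by (simp add: scalar_prod_def atLeast0LessThan)

lemma cscalar_prod_sum:
  fixes v w :: "complex Matrix.vec"
  shows "v \<bullet>c w = (\<Sum>k<dim_vec w. v $ k * cnj (w $ k))"
  by (simp add: scalar_prod_def atLeast0LessThan)

lemma mult_assoc_dim:
  assumes "dim_col A = dim_row B" "dim_col B = dim_row C"
  shows "(A * B) * C = A * (B * (C :: complex mat))"
  using assms by (intro assoc_mult_mat[of A "dim_row A" "dim_col A" B "dim_col B" C "dim_col C"]) auto

lemma mat_adjoint_mult:
  fixes A B :: "complex mat"
  assumes "dim_col A = dim_row B"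
  shows "mat_adjoint (A * B) = mat_adjoint B * mat_adjoint A"
  by (rule eq_matI) (use assms in \<open>auto simp: mult_index mult.commute simp del: index_mult_mat(1)\<close>)

lemma mat_adjoint_adjoint [simp]: "mat_adjoint (mat_adjoint A) = (A :: complex mat)"
  by (rule eq_matI) auto

lemma unitary_mat_carrier: "unitary_mat d U \<Longrightarrow> U \<in> carrier_mat d d"
  by (simp add: unitary_mat_def)

lemma unitary_mat_right:
  assumes "unitary_mat d U"
  shows "U * mat_adjoint U = 1\<^sub>m d"
  using assms mat_mult_left_right_inverse[of "mat_adjoint U" d U] unfolding unitary_mat_def
  by (metis carrier_matD carrier_matI mat_adjoint_dim)

lemma unitary_matI_right:
  assumes "U \<in> carrier_mat d d" "U * mat_adjoint U = 1\<^sub>m d"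
  shows "unitary_mat d U"
  using assms mat_mult_left_right_inverse[of U d "mat_adjoint U"] unfolding unitary_mat_def
  by (metis carrier_matD carrier_matI mat_adjoint_dim)

lemma unitary_mat_adjoint:
  assumes "unitary_mat d U"
  shows "unitary_mat d (mat_adjoint U)"
  using assms unitary_mat_right[OF assms] unfolding unitary_mat_def
  by (auto intro!: carrier_matI)

lemma unitary_mat_mult:
  assumes "unitary_mat d U" "unitary_mat d V"
  shows "unitary_mat d (U * V)"
proof -
  have c: "U \<in> carrier_mat d d" "V \<in> carrier_mat d d"
    using assms by (auto simp: unitary_mat_def)
  have "mat_adjoint (U * V) * (U * V) = mat_adjoint V * ((mat_adjoint U * U) * V)"
    using c by (simp add: mat_adjoint_mult mult_assoc_dim del: assoc_mult_mat)
  also have "\<dots> = 1\<^sub>m d"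
    using assms c by (auto simp: unitary_mat_def)
  finally show ?thesis using c by (auto simp: unitary_mat_def)
qed

lemma unitary_mat_one: "unitary_mat d (1\<^sub>m d)"
proof -
  have "mat_adjoint (1\<^sub>m d) = (1\<^sub>m d :: complex mat)"
    by (rule eq_matI) auto
  then show ?thesis by (simp add: unitary_mat_def)
qed

text \<open>A square matrix with rows conjugate to \<open>g i\<close> for \<open>i\<close> in
  \<open>I\<close> and zero rows elsewhere is singular because some row is zero; a kernel vector,
  normalised, is the required \<open>v\<close>.\<close>

lemma orthogonal_vector_exists:
  fixes g :: "nat \<Rightarrow> nat \<Rightarrow> complex"
  assumes I: "I \<subseteq> {..<a}" "I \<noteq> {..<a}"
  shows "\<exists>v. (\<Sum>k<a. v k * cnj (v k)) = 1 \<and> (\<forall>i\<in>I. (\<Sum>k<a. g i k * cnj (v k)) = 0)"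
proof -
  obtain m where m: "m < a" "m \<notin> I" using I by auto
  define M where "M = Matrix.mat a a (\<lambda>(i, j). if i \<in> I then cnj (g i j) else 0)"
  have M: "M \<in> carrier_mat a a" by (simp add: M_def)
  \<comment> \<open>Row \<open>m\<close> of \<open>M\<close> is zero, so the \<open>m\<close>-th
    unit vector lies in the kernel of the transpose, which forces \<open>det M = 0\<close>.\<close>
  have "transpose_mat M *\<^sub>v unit_vec a m = 0\<^sub>v a"
    using m by (intro eq_vecI) (auto simp: M_def mult_vec_index)
  moreover have "unit_vec a m \<noteq> (0\<^sub>v a :: complex Matrix.vec)"
    using m by (metis index_unit_vec(2) index_zero_vec(1) one_neq_zero)
  ultimately have "Determinant.det (transpose_mat M) = 0"
    using det_0_iff_vec_prod_zero[of "transpose_mat M" a] M unit_vec_carrier[of a m]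
      transpose_carrier_mat[of M a a] by blast
  then have "Determinant.det M = 0" using Determinant.det_transpose[OF M] by simp
  then obtain v where v: "v \<in> carrier_vec a" "v \<noteq> 0\<^sub>v a" "M *\<^sub>v v = 0\<^sub>v a"
    using det_0_iff_vec_prod_zero[OF M] by auto
  define s where "s = (\<Sum>k<a. (cmod (v $ k))\<^sup>2)"
  obtain j where j: "j < a" "v $ j \<noteq> 0"
    using v by (metis carrier_vecD eq_vecI index_zero_vec)
  have "s > 0" unfolding s_def
    by (rule sum_pos2[of _ j]) (use j in auto)
  define u where "u k = v $ k / of_real (sqrt s)" for k
  have "(\<Sum>k<a. u k * cnj (u k)) = (\<Sum>k<a. of_real ((cmod (v $ k))\<^sup>2 / s))"
    using \<open>s > 0\<close> by (intro sum.cong) (auto simp: u_def complex_norm_square[symmetric] simp flip: of_real_mult)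
  also have "\<dots> = of_real (s / s)" unfolding s_def by (simp only: sum_divide_distrib of_real_sum)
  finally have 1: "(\<Sum>k<a. u k * cnj (u k)) = 1" using \<open>s > 0\<close> by simp
  have "(\<Sum>k<a. g i k * cnj (u k)) = 0" if "i \<in> I" for i
  proof -
    have ia: "i < a" using that I by auto
    have "(M *\<^sub>v v) $ i = 0" using v ia by simp
    then have "(\<Sum>k<a. cnj (g i k) * v $ k) = 0"
      using ia that v by (subst (asm) mult_vec_index) (auto simp: M_def)
    then have "cnj (\<Sum>k<a. cnj (g i k) * v $ k) = 0" by simp
    then have "(\<Sum>k<a. g i k * cnj (v $ k)) = 0" by simp
    then have "(\<Sum>k<a. g i k * cnj (v $ k)) / of_real (sqrt s) = 0" by simp
    then show ?thesis by (simp add: u_def sum_divide_distrib)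
  qed
  with 1 show ?thesis by blast
qed

text \<open>Induction on the number of free indices, each step filling one row by
  \<open>orthogonal_vector_exists\<close>. The prescribed rows sit at an arbitrary index set, so
  that the polar decomposition can prescribe exactly the rows with nonzero singular value.\<close>

lemma orthonormal_extend:
  fixes g :: "nat \<Rightarrow> nat \<Rightarrow> complex"
  assumes "I \<subseteq> {..<a}"
    and "\<And>i j. i \<in> I \<Longrightarrow> j \<in> I \<Longrightarrow> (\<Sum>k<a. g i k * cnj (g j k)) = (if i = j then 1 else 0)"
  shows "\<exists>V. unitary_mat a V \<and> (\<forall>i\<in>I. \<forall>k<a. V $$ (i, k) = g i k)"
  using assms
proof (induction "card ({..<a} - I)" arbitrary: I g)
  case 0
  then have I: "I = {..<a}" by auto
  define V where "V = Matrix.mat a a (\<lambda>(i, j). g i j)"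
  have "V * mat_adjoint V = 1\<^sub>m a"
    by (rule eq_matI) (use 0 I in \<open>auto simp: V_def mult_index simp del: index_mult_mat(1)\<close>)
  then have "unitary_mat a V" by (intro unitary_matI_right) (auto simp: V_def)
  then show ?case using I by (intro exI[of _ V]) (auto simp: V_def)
next
  case (Suc n)
  then obtain m where m: "m < a" "m \<notin> I"
    by (metis Diff_iff card.empty equals0I lessThan_iff nat.distinct(1))
  then have "I \<noteq> {..<a}" by auto
  from orthogonal_vector_exists[OF Suc.prems(1) this, of g] obtain v where
    v: "(\<Sum>k<a. v k * cnj (v k)) = 1" "\<And>i. i \<in> I \<Longrightarrow> (\<Sum>k<a. g i k * cnj (v k)) = 0"
    by blast
  have v': "(\<Sum>k<a. v k * cnj (g i k)) = 0" if "i \<in> I" for i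
  proof -
    have "cnj (\<Sum>k<a. g i k * cnj (v k)) = 0" using v(2)[OF that] by simp
    then show ?thesis by (simp add: mult.commute)
  qed
  define h where "h = g(m := v)"
  have "{..<a} - I = insert m ({..<a} - insert m I)" using m by auto
  then have "card ({..<a} - I) = Suc (card ({..<a} - insert m I))"
    by (metis Diff_iff card_insert_disjoint finite_Diff finite_lessThan insertI1)
  then have c: "n = card ({..<a} - insert m I)" using Suc.hyps(2) by simp
  have "\<exists>V. unitary_mat a V \<and> (\<forall>i\<in>insert m I. \<forall>k<a. V $$ (i, k) = h i k)"
  proof (rule Suc.hyps(1)[OF c])
    show "insert m I \<subseteq> {..<a}" using Suc.prems(1) m by auto
    show "(\<Sum>k<a. h i k * cnj (h j k)) = (if i = j then 1 else 0)"
      if "i \<in> insert m I" "j \<in> insert m I" for i j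
      using that v v' Suc.prems(2)[of i j] m unfolding h_def by auto
  qed
  then show ?case using m unfolding h_def by (metis fun_upd_other insertCI)
qed

section \<open>Real diagonal matrices and diagonalisation of Hermitian matrices\<close>

definition diag_real :: "nat \<Rightarrow> (nat \<Rightarrow> real) \<Rightarrow> complex mat" where
  "diag_real n d = Matrix.mat n n (\<lambda>(i, j). if i = j then complex_of_real (d i) else 0)"

lemma diag_real_dim [simp]: "dim_row (diag_real n d) = n" "dim_col (diag_real n d) = n"
  by (auto simp: diag_real_def)

lemma mat_adjoint_diag_real [simp]: "mat_adjoint (diag_real n d) = diag_real n d"
  by (rule eq_matI) (auto simp: diag_real_def)

lemma mult_diag_real_index:
  assumes "i < dim_row A" "j < n" "dim_col A = n"
  shows "(A * diag_real n d) $$ (i, j) = A $$ (i, j) * of_real (d j)"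
  using assms by (simp add: mult_index diag_real_def if_distrib cong: if_cong del: index_mult_mat(1))

lemma conj_diag_index:
  assumes "i < dim_row U" "j < dim_row U" "dim_col U = n"
  shows "(U * diag_real n d * mat_adjoint U) $$ (i, j) =
    (\<Sum>k<n. of_real (d k) * (U $$ (i, k) * cnj (U $$ (j, k))))"
  using assms
  by (subst mult_index) (auto simp: mult_diag_real_index mult_ac simp del: index_mult_mat(1) intro!: sum.cong)

text \<open>Deflation: a unit eigenvector of \<open>A\<close> becomes column 0 of a unitary
  \<open>W\<close>. In that basis \<open>A\<close> is Hermitian with column 0 a multiple of the
  first unit vector, hence block diagonal, and the induction hypothesis diagonalises the remaining
  block.\<close>

lemma hermitian_spectral:
  assumes "A \<in> carrier_mat n n" "mat_adjoint A = A"
  shows "\<exists>U d. unitary_mat n U \<and> A = U * diag_real n d * mat_adjoint U"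
  using assms
proof (induction n arbitrary: A)
  case 0
  then show ?case
    by (intro exI[of _ "1\<^sub>m 0"] exI) (auto simp: unitary_mat_one intro!: eq_matI)
next
  case (Suc n)
  note A = Suc.prems(1)
  from spectrum_non_empty[OF A] obtain l u where u: "u \<in> carrier_vec (Suc n)" "u \<noteq> 0\<^sub>v (Suc n)"
    "A *\<^sub>v u = l \<cdot>\<^sub>v u"
    using A by (auto simp: spectrum_def eigenvalue_def eigenvector_def)
  define s where "s = (\<Sum>k<Suc n. (cmod (u $ k))\<^sup>2)"
  obtain j where j: "j < Suc n" "u $ j \<noteq> 0"
    using u by (metis carrier_vecD eq_vecI index_zero_vec)
  have "s > 0" unfolding s_def
    by (rule sum_pos2[of _ j]) (use j in auto)
  \<comment> \<open>\<open>orthonormal_extend\<close> prescribes rows, so the conjugate of the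
    normalised eigenvector becomes row 0 of \<open>V\<close> and the eigenvector itself column 0 of
    the adjoint \<open>W\<close>.\<close>
  define g where "g = (\<lambda>(i::nat) k. cnj (u $ k) / of_real (sqrt s))"
  have "(\<Sum>k<Suc n. g 0 k * cnj (g 0 k)) = (\<Sum>k<Suc n. of_real ((cmod (u $ k))\<^sup>2 / s))"
    using \<open>s > 0\<close> by (intro sum.cong) (auto simp: g_def complex_norm_square[symmetric] mult.commute[of "cnj z" z for z] simp flip: of_real_mult)
  also have "\<dots> = of_real (s / s)" unfolding s_def by (simp only: sum_divide_distrib of_real_sum)
  finally have g: "(\<Sum>k<Suc n. g 0 k * cnj (g 0 k)) = 1" using \<open>s > 0\<close> by simp
  obtain V where V: "unitary_mat (Suc n) V" "\<And>k. k < Suc n \<Longrightarrow> V $$ (0, k) = g 0 k"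
    using orthonormal_extend[of "{0}" "Suc n" g] g by auto
  define W where "W = mat_adjoint V"
  have W: "unitary_mat (Suc n) W" using V(1) unitary_mat_adjoint by (simp add: W_def)
  have Wc: "W \<in> carrier_mat (Suc n) (Suc n)" using W by (rule unitary_mat_carrier)
  have WW: "mat_adjoint W * W = 1\<^sub>m (Suc n)" using W by (simp add: unitary_mat_def)
  have W0: "W $$ (k, 0) = u $ k / of_real (sqrt s)" if "k < Suc n" for k
    using that V(2)[of k] unitary_mat_carrier[OF V(1)] by (auto simp: W_def g_def)
  define B where "B = mat_adjoint W * (A * W)"
  have B: "B \<in> carrier_mat (Suc n) (Suc n)" using Wc A by (auto simp: B_def)
  have AB: "A = W * (B * mat_adjoint W)"
  proof -
    have "W * (B * mat_adjoint W) = (W * mat_adjoint W) * (A * (W * mat_adjoint W))"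
      using Wc A by (simp add: B_def mult_assoc_dim del: assoc_mult_mat)
    then show ?thesis using unitary_mat_right[OF W] A by simp
  qed
  have Bh: "mat_adjoint B = B"
    using Wc A Suc.prems(2) by (simp add: B_def mat_adjoint_mult mult_assoc_dim del: assoc_mult_mat)
  have Bh': "B $$ (i, j) = cnj (B $$ (j, i))" if "i < Suc n" "j < Suc n" for i j
    using arg_cong[OF Bh, of "\<lambda>M. M $$ (i, j)"] that B by auto
  have AW: "(A * W) $$ (k, 0) = l * W $$ (k, 0)" if "k < Suc n" for k
  proof -
    have "(A * W) $$ (k, 0) = (\<Sum>j<Suc n. A $$ (k, j) * u $ j) / of_real (sqrt s)"
      using that A Wc by (subst mult_index) (auto simp: W0 sum_divide_distrib simp del: sum.lessThan_Suc)
    also have "(\<Sum>j<Suc n. A $$ (k, j) * u $ j) = (A *\<^sub>v u) $ k"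
      using that A u by (subst mult_vec_index) auto
    also have "\<dots> = l * u $ k" using u that by auto
    finally show ?thesis using W0[OF that] by simp
  qed
  \<comment> \<open>Column 0 of \<open>A * W\<close> is \<open>l\<close> times column 0 of
    \<open>W\<close>, and multiplying by the adjoint of \<open>W\<close> turns this into
    \<open>l\<close> times the first unit vector.\<close>
  have B0: "B $$ (i, 0) = (if i = 0 then l else 0)" if "i < Suc n" for i
  proof -
    have "B $$ (i, 0) = (\<Sum>k<Suc n. mat_adjoint W $$ (i, k) * (A * W) $$ (k, 0))"
      using that A Wc unfolding B_def by (subst mult_index) auto
    also have "\<dots> = l * (\<Sum>k<Suc n. mat_adjoint W $$ (i, k) * W $$ (k, 0))"
      unfolding sum_distrib_left by (rule sum.cong) (auto simp: AW simp del: index_mult_mat(1))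
    also have "\<dots> = l * (mat_adjoint W * W) $$ (i, 0)"
      using that Wc by (subst mult_index) auto
    finally have "B $$ (i, 0) = l * (mat_adjoint W * W) $$ (i, 0)" .
    then show ?thesis using WW that by simp
  qed
  \<comment> \<open>The eigenvalue is a diagonal entry of the Hermitian matrix \<open>B\<close>,
    hence real, as \<open>diag_real\<close> demands.\<close>
  have "l = cnj l"
    using Bh'[of 0 0] unfolding B0[of 0, OF zero_less_Suc] by simp
  then have l: "of_real (Re l) = l" by (metis Reals_cnj_iff of_real_Re)
  define C where "C = Matrix.mat n n (\<lambda>(i, j). B $$ (Suc i, Suc j))"
  have "mat_adjoint C = C"
    by (rule eq_matI) (use Bh'[symmetric] in \<open>auto simp: C_def\<close>)
  with Suc.IH[of C] obtain U d where U: "unitary_mat n U" "C = U * diag_real n d * mat_adjoint U"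
    by (auto simp: C_def)
  have Uc: "U \<in> carrier_mat n n" using U(1) by (rule unitary_mat_carrier)
  \<comment> \<open>The direct sum of the 1 by 1 identity and \<open>U\<close>, matching the block
    form of \<open>B\<close>.\<close>
  define U' where "U' = Matrix.mat (Suc n) (Suc n) (\<lambda>(i, j). case i of 0 \<Rightarrow> (if j = 0 then 1 else 0)
    | Suc i' \<Rightarrow> (case j of 0 \<Rightarrow> 0 | Suc j' \<Rightarrow> U $$ (i', j')))"
  define d' where "d' = case_nat (Re l) d"
  have "U' * mat_adjoint U' = 1\<^sub>m (Suc n)"
  proof (rule eq_matI)
    fix i j assume "i < dim_row (1\<^sub>m (Suc n) :: complex mat)" "j < dim_col (1\<^sub>m (Suc n) :: complex mat)"
    then have ij: "i < Suc n" "j < Suc n" by auto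
    have UU: "(\<Sum>k<n. U $$ (i', k) * cnj (U $$ (j', k))) = (if i' = j' then 1 else 0)"
      if "i' < n" "j' < n" for i' j'
      using arg_cong[OF unitary_mat_right[OF U(1)], of "\<lambda>M. M $$ (i', j')"] that Uc
      by (subst (asm) mult_index) auto
    show "(U' * mat_adjoint U') $$ (i, j) = 1\<^sub>m (Suc n) $$ (i, j)"
      using ij by (subst mult_index)
        (auto simp: U'_def sum.lessThan_Suc_shift UU simp del: sum.lessThan_Suc split: nat.splits)
  qed (auto simp: U'_def)
  then have U': "unitary_mat (Suc n) U'"
    by (intro unitary_matI_right) (auto simp: U'_def)
  have BU: "B = U' * diag_real (Suc n) d' * mat_adjoint U'"
  proof (rule eq_matI)
    fix i j assume "i < dim_row (U' * diag_real (Suc n) d' * mat_adjoint U')"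
      "j < dim_col (U' * diag_real (Suc n) d' * mat_adjoint U')"
    then have ij: "i < Suc n" "j < Suc n" by (auto simp: U'_def)
    have UU: "(\<Sum>k<n. of_real (d k) * (U $$ (i', k) * cnj (U $$ (j', k)))) = B $$ (Suc i', Suc j')"
      if "i' < n" "j' < n" for i' j'
      using arg_cong[OF U(2), of "\<lambda>M. M $$ (i', j')"] that Uc
      by (subst (asm) conj_diag_index) (auto simp: C_def)
    have e: "(U' * diag_real (Suc n) d' * mat_adjoint U') $$ (i, j) =
      (\<Sum>k<Suc n. of_real (d' k) * (U' $$ (i, k) * cnj (U' $$ (j, k))))"
      using ij by (intro conj_diag_index) (auto simp: U'_def)
    have B0': "B $$ (0, Suc j') = 0" if "j' < n" for j'
      using Bh'[of 0 "Suc j'"] B0[of "Suc j'"] that by simp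
    show "B $$ (i, j) = (U' * diag_real (Suc n) d' * mat_adjoint U') $$ (i, j)"
      unfolding e using ij l B0 B0'
      by (auto simp: U'_def d'_def sum.lessThan_Suc_shift UU simp del: sum.lessThan_Suc split: nat.splits)
  qed (use B in \<open>auto simp: U'_def\<close>)
  have "U' \<in> carrier_mat (Suc n) (Suc n)" using U' by (rule unitary_mat_carrier)
  then have "A = (W * U') * diag_real (Suc n) d' * mat_adjoint (W * U')"
    using Wc by (subst AB, subst BU) (simp add: mat_adjoint_mult mult_assoc_dim del: assoc_mult_mat)
  then show ?case using unitary_mat_mult[OF W U'] by blast
qed

section \<open>Polar decomposition and an approximate Uhlmann theorem\<close>

definition mat_trace :: "complex mat \<Rightarrow> complex" where
  "mat_trace A = (\<Sum>i<dim_row A. A $$ (i, i))"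

definition hs_norm_sq :: "complex mat \<Rightarrow> real" where
  "hs_norm_sq A = (\<Sum>i<dim_row A. \<Sum>j<dim_col A. (cmod (A $$ (i, j)))\<^sup>2)"

lemma hs_norm_sq_trace: "of_real (hs_norm_sq A) = mat_trace (A * mat_adjoint A)"
proof -
  have "mat_trace (A * mat_adjoint A) = (\<Sum>i<dim_row A. (A * mat_adjoint A) $$ (i, i))"
    by (simp add: mat_trace_def)
  also have "\<dots> = (\<Sum>i<dim_row A. \<Sum>j<dim_col A. of_real ((cmod (A $$ (i, j)))\<^sup>2))"
    by (rule sum.cong[OF refl], subst mult_index) (auto simp only: complex_norm_square, auto)
  finally show ?thesis by (simp add: hs_norm_sq_def)
qed

lemma mat_trace_mult_comm:
  assumes "dim_col A = dim_row B" "dim_col B = dim_row A"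
  shows "mat_trace (A * B) = mat_trace (B * A)"
proof -
  have "mat_trace (A * B) = (\<Sum>i<dim_row A. \<Sum>k<dim_row B. A $$ (i, k) * B $$ (k, i))"
    using assms unfolding mat_trace_def by (intro sum.cong) (auto simp: mult_index simp del: index_mult_mat(1))
  also have "\<dots> = (\<Sum>k<dim_row B. \<Sum>i<dim_row A. B $$ (k, i) * A $$ (i, k))"
    by (subst sum.swap) (simp add: mult.commute)
  also have "\<dots> = mat_trace (B * A)"
    using assms unfolding mat_trace_def by (intro sum.cong) (auto simp: mult_index simp del: index_mult_mat(1))
  finally show ?thesis .
qed

text \<open>The quadratic form at \<open>v\<close> is the sum over \<open>k\<close> of
  \<open>x k\<close> times the squared modulus of the inner product of \<open>v\<close> with column
  \<open>k\<close> of \<open>W\<close>.\<close>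

lemma psd_conj_diag:
  assumes W: "W \<in> carrier_mat d d" and x: "\<And>k. k < d \<Longrightarrow> x k \<ge> 0"
  shows "psd d (W * diag_real d x * mat_adjoint W)"
proof -
  let ?M = "W * diag_real d x * mat_adjoint W"
  have M: "?M \<in> carrier_mat d d" using W by auto
  have q: "(?M *\<^sub>v v) \<bullet>c v = of_real (\<Sum>k<d. x k * (cmod (\<Sum>j<d. cnj (W $$ (j, k)) * v $ j))\<^sup>2)"
    if v: "v \<in> carrier_vec d" for v
  proof -
    have sq: "(\<Sum>i<d. \<Sum>j<d. r * (y j * cnj (y i))) = r * ((\<Sum>j<d. y j) * cnj (\<Sum>j<d. y j))"
      for r and y :: "nat \<Rightarrow> complex"
      unfolding cnj_sum sum_product by (subst sum.swap) (simp add: sum_distrib_left)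
    have "(?M *\<^sub>v v) \<bullet>c v = (\<Sum>i<d. (?M *\<^sub>v v) $ i * cnj (v $ i))"
      using v by (simp add: cscalar_prod_sum)
    also have "\<dots> = (\<Sum>i<d. (\<Sum>j<d. ?M $$ (i, j) * v $ j) * cnj (v $ i))"
      using v W by (intro sum.cong refl, subst mult_vec_index) auto
    also have "\<dots> = (\<Sum>i<d. \<Sum>j<d. \<Sum>k<d. of_real (x k) * ((cnj (W $$ (j, k)) * v $ j) * cnj (cnj (W $$ (i, k)) * v $ i)))"
      unfolding sum_distrib_right using W
      by (intro sum.cong refl, subst conj_diag_index) (auto simp: sum_distrib_left sum_distrib_right mult_ac)
    also have "\<dots> = (\<Sum>i<d. \<Sum>k<d. \<Sum>j<d. of_real (x k) * ((cnj (W $$ (j, k)) * v $ j) * cnj (cnj (W $$ (i, k)) * v $ i)))"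
      by (rule sum.cong[OF refl]) (rule sum.swap)
    also have "\<dots> = (\<Sum>k<d. \<Sum>i<d. \<Sum>j<d. of_real (x k) * ((cnj (W $$ (j, k)) * v $ j) * cnj (cnj (W $$ (i, k)) * v $ i)))"
      by (rule sum.swap)
    also have "\<dots> = (\<Sum>k<d. of_real (x k) * ((\<Sum>j<d. cnj (W $$ (j, k)) * v $ j) * cnj (\<Sum>j<d. cnj (W $$ (j, k)) * v $ j)))"
      by (rule sum.cong[OF refl]) (rule sq)
    also have "\<dots> = of_real (\<Sum>k<d. x k * (cmod (\<Sum>j<d. cnj (W $$ (j, k)) * v $ j))\<^sup>2)"
      by (simp only: complex_norm_square[symmetric] of_real_sum of_real_mult)
    finally show ?thesis .
  qed
  show ?thesis unfolding psd_def
    using M q x by (auto intro!: sum_nonneg)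
qed

text \<open>By unitarity the complementary operator has the same form with \<open>1 - x k\<close> in
  place of \<open>x k\<close>, so positivity applies to both.\<close>

lemma povm_elem_conj_diag:
  assumes W: "unitary_mat d W" and x: "\<And>k. k < d \<Longrightarrow> 0 \<le> x k \<and> x k \<le> 1"
  shows "povm_elem d (W * diag_real d x * mat_adjoint W)"
proof -
  have Wc: "W \<in> carrier_mat d d" using W by (rule unitary_mat_carrier)
  have "1\<^sub>m d - W * diag_real d x * mat_adjoint W = W * diag_real d (\<lambda>k. 1 - x k) * mat_adjoint W"
  proof (rule eq_matI)
    fix i j assume "i < dim_row (W * diag_real d (\<lambda>k. 1 - x k) * mat_adjoint W)"
      "j < dim_col (W * diag_real d (\<lambda>k. 1 - x k) * mat_adjoint W)"
    then have ij: "i < d" "j < d" using Wc by auto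
    have "(\<Sum>k<d. W $$ (i, k) * cnj (W $$ (j, k))) = 1\<^sub>m d $$ (i, j)"
      using arg_cong[OF unitary_mat_right[OF W], of "\<lambda>M. M $$ (i, j)"] ij Wc
      by (subst (asm) mult_index) auto
    moreover have "(W * diag_real d x * mat_adjoint W) $$ (i, j) =
        (\<Sum>k<d. of_real (x k) * (W $$ (i, k) * cnj (W $$ (j, k))))"
      "(W * diag_real d (\<lambda>k. 1 - x k) * mat_adjoint W) $$ (i, j) =
        (\<Sum>k<d. of_real (1 - x k) * (W $$ (i, k) * cnj (W $$ (j, k))))"
      using conj_diag_index[of i W j d x] conj_diag_index[of i W j d "\<lambda>k. 1 - x k"] ij Wc
      by (simp_all del: index_mult_mat(1))
    ultimately show "(1\<^sub>m d - W * diag_real d x * mat_adjoint W) $$ (i, j) =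
        (W * diag_real d (\<lambda>k. 1 - x k) * mat_adjoint W) $$ (i, j)"
      using ij Wc by (simp add: left_diff_distrib sum_subtractf del: index_mult_mat(1))
  qed (use Wc in auto)
  then show ?thesis
    unfolding povm_elem_def using psd_conj_diag[OF Wc] x by (metis diff_ge_0_iff_ge)
qed

text \<open>Diagonalise \<open>B * mat_adjoint B\<close> by \<open>W\<close>. The rows of
  \<open>F = mat_adjoint W * B\<close> are then orthogonal with squared norms \<open>d i\<close>;
  normalised and completed they form a co-isometry \<open>Q\<close> with
  \<open>F = diag_real c s * Q\<close>, and \<open>R = W * Q\<close> restores a positive left
  factor. There is room for \<open>c\<close> orthonormal rows of length \<open>a\<close> because
  \<open>c \<le> a\<close>.\<close>

lemma left_polar_decomposition:
  assumes B: "B \<in> carrier_mat c a" and "c \<le> a"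
  obtains W s R where "unitary_mat c W" "\<And>k. k < c \<Longrightarrow> s k \<ge> 0"
    "R \<in> carrier_mat c a" "R * mat_adjoint R = 1\<^sub>m c"
    "B = W * diag_real c s * mat_adjoint W * R"
proof -
  have "mat_adjoint (B * mat_adjoint B) = B * mat_adjoint B"
    by (simp add: mat_adjoint_mult)
  moreover have "B * mat_adjoint B \<in> carrier_mat c c"
    by (rule carrier_matI) (use B in auto)
  ultimately obtain W d where W: "unitary_mat c W" and BB: "B * mat_adjoint B = W * diag_real c d * mat_adjoint W"
    using hermitian_spectral by blast
  have Wc: "W \<in> carrier_mat c c" using W by (rule unitary_mat_carrier)
  have WW: "mat_adjoint W * W = 1\<^sub>m c" using W by (simp add: unitary_mat_def)
  define F where "F = mat_adjoint W * B"
  have F: "F \<in> carrier_mat c a" using Wc B by (auto simp: F_def)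
  have "F * mat_adjoint F = mat_adjoint W * ((B * mat_adjoint B) * W)"
    using Wc B by (simp add: F_def mat_adjoint_mult mult_assoc_dim del: assoc_mult_mat)
  also have "\<dots> = (mat_adjoint W * W) * (diag_real c d * (mat_adjoint W * W))"
    unfolding BB using Wc by (simp add: mult_assoc_dim del: assoc_mult_mat)
  also have "\<dots> = diag_real c d" unfolding WW by (simp add: carrier_matI)
  finally have FF: "F * mat_adjoint F = diag_real c d" .
  have FF': "(\<Sum>k<a. F $$ (i, k) * cnj (F $$ (j, k))) = (if i = j then of_real (d i) else 0)"
    if "i < c" "j < c" for i j
    using arg_cong[OF FF, of "\<lambda>M. M $$ (i, j)"] that F
    by (subst (asm) mult_index) (auto simp: diag_real_def)
  have Fn: "(\<Sum>k<a. (cmod (F $$ (i, k)))\<^sup>2) = d i" if "i < c" for i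
  proof -
    have "complex_of_real (\<Sum>k<a. (cmod (F $$ (i, k)))\<^sup>2) = of_real (d i)"
      using FF'[OF that that] by (simp only: of_real_sum complex_norm_square) simp
    then show ?thesis by (simp only: of_real_eq_iff)
  qed
  have d: "d i \<ge> 0" if "i < c" for i
    using Fn[OF that] by (metis sum_nonneg zero_le_power2)
  define s where "s i = sqrt (d i)" for i
  \<comment> \<open>Rows of \<open>F\<close> with \<open>d i = 0\<close> vanish and cannot be
    normalised; the extension to \<open>V\<close> supplies arbitrary orthonormal rows there, which
    \<open>s i = 0\<close> cancels again.\<close>
  define I where "I = {i. i < c \<and> d i \<noteq> 0}"
  obtain V where V: "unitary_mat a V" "\<And>i k. i \<in> I \<Longrightarrow> k < a \<Longrightarrow> V $$ (i, k) = F $$ (i, k) / of_real (s i)"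
  proof -
    have "(\<Sum>k<a. F $$ (i, k) / of_real (s i) * cnj (F $$ (j, k) / of_real (s j))) = (if i = j then 1 else 0)"
      if "i \<in> I" "j \<in> I" for i j
    proof -
      have ij: "i < c" "j < c" "d i \<noteq> 0" using that by (auto simp: I_def)
      have "(\<Sum>k<a. F $$ (i, k) / of_real (s i) * cnj (F $$ (j, k) / of_real (s j))) =
        (\<Sum>k<a. F $$ (i, k) * cnj (F $$ (j, k))) / of_real (s i * s j)"
        by (simp add: sum_divide_distrib)
      also have "\<dots> = (if i = j then 1 else 0)"
        using FF'[OF ij(1,2)] ij d[OF ij(1)] by (auto simp: s_def simp flip: of_real_mult)
      finally show ?thesis .
    qed
    moreover have "I \<subseteq> {..<a}" using \<open>c \<le> a\<close> by (auto simp: I_def)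
    ultimately obtain V where "unitary_mat a V" "\<forall>i\<in>I. \<forall>k<a. V $$ (i, k) = F $$ (i, k) / of_real (s i)"
      using orthonormal_extend[of I a "\<lambda>i k. F $$ (i, k) / of_real (s i)"] by blast
    then show ?thesis using that by blast
  qed
  have Vc: "V \<in> carrier_mat a a" using V(1) by (rule unitary_mat_carrier)
  \<comment> \<open>The first \<open>c\<close> rows of \<open>V\<close>.\<close>
  define Q where "Q = Matrix.mat c a (\<lambda>(i, k). V $$ (i, k))"
  have QQ: "Q * mat_adjoint Q = 1\<^sub>m c"
  proof (rule eq_matI)
    fix i j assume "i < dim_row (1\<^sub>m c :: complex mat)" "j < dim_col (1\<^sub>m c :: complex mat)"
    then have ij: "i < c" "j < c" by auto
    have "(\<Sum>k<a. V $$ (i, k) * cnj (V $$ (j, k))) = 1\<^sub>m a $$ (i, j)"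
      using arg_cong[OF unitary_mat_right[OF V(1)], of "\<lambda>M. M $$ (i, j)"] ij Vc \<open>c \<le> a\<close>
      by (subst (asm) mult_index) auto
    then show "(Q * mat_adjoint Q) $$ (i, j) = 1\<^sub>m c $$ (i, j)"
      using ij \<open>c \<le> a\<close> by (subst mult_index) (auto simp: Q_def)
  qed (auto simp: Q_def)
  have Qc: "Q \<in> carrier_mat c a" by (simp add: Q_def)
  have FQ: "F = diag_real c s * Q"
  proof (rule eq_matI)
    fix i k assume "i < dim_row (diag_real c s * Q)" "k < dim_col (diag_real c s * Q)"
    then have ik: "i < c" "k < a" using Qc by auto
    have "(diag_real c s * Q) $$ (i, k) = of_real (s i) * V $$ (i, k)"
      using ik by (subst mult_index) (auto simp: Q_def diag_real_def if_distrib[of "\<lambda>x. x * _"] cong: if_cong)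
    also have "\<dots> = F $$ (i, k)"
    proof (cases "i \<in> I")
      case True
      then show ?thesis using V(2)[OF True ik(2)] d[OF ik(1)] by (auto simp: I_def s_def)
    next
      case False
      then have "d i = 0" using ik by (auto simp: I_def)
      with Fn[OF ik(1)] have "(\<Sum>k<a. (cmod (F $$ (i, k)))\<^sup>2) = 0" by simp
      then have "F $$ (i, k) = 0" using ik by (subst (asm) sum_nonneg_eq_0_iff) auto
      then show ?thesis using \<open>d i = 0\<close> by (simp add: s_def)
    qed
    finally show "F $$ (i, k) = (diag_real c s * Q) $$ (i, k)" by simp
  qed (use F Qc in auto)
  define R where "R = W * Q"
  have Rc: "R \<in> carrier_mat c a" using Wc Qc by (auto simp: R_def)
  have "R * mat_adjoint R = W * ((Q * mat_adjoint Q) * mat_adjoint W)"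
    using Wc Qc by (simp add: R_def mat_adjoint_mult mult_assoc_dim del: assoc_mult_mat)
  then have RR: "R * mat_adjoint R = 1\<^sub>m c"
    using QQ unitary_mat_right[OF W] Wc by simp
  have "B = (W * mat_adjoint W) * B" using unitary_mat_right[OF W] B by simp
  also have "\<dots> = W * F" using Wc B by (simp add: F_def mult_assoc_dim del: assoc_mult_mat)
  also have "\<dots> = W * (diag_real c s * ((mat_adjoint W * W) * Q))"
    using FQ WW Qc by simp
  also have "\<dots> = W * diag_real c s * mat_adjoint W * R"
    using Wc Qc by (simp add: R_def mult_assoc_dim del: assoc_mult_mat)
  finally have "B = W * diag_real c s * mat_adjoint W * R" .
  moreover have "s k \<ge> 0" if "k < c" for k using d[OF that] by (simp add: s_def)
  ultimately show ?thesis using that[OF W _ Rc RR] by blast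
qed

text \<open>Each co-isometry consists of the first \<open>c\<close> rows of a unitary, so
  \<open>R = J * V\<close> and \<open>R' = J * V'\<close> for the same truncated identity
  \<open>J\<close>; the adjoint of \<open>V\<close> times \<open>V'\<close> carries one to the
  other.\<close>

lemma coisometries_unitarily_equivalent:
  assumes R: "R \<in> carrier_mat c a" "R * mat_adjoint R = 1\<^sub>m c"
    and R': "R' \<in> carrier_mat c a" "R' * mat_adjoint R' = 1\<^sub>m c"
    and "c \<le> a"
  shows "\<exists>U. unitary_mat a U \<and> R * U = R'"
proof -
  define J where "J = (Matrix.mat c a (\<lambda>(i, j). if i = j then 1 else 0) :: complex mat)"
  have J: "J \<in> carrier_mat c a" by (simp add: J_def)
  have ext: "\<exists>V. unitary_mat a V \<and> J * V = S"
    if S: "S \<in> carrier_mat c a" "S * mat_adjoint S = 1\<^sub>m c" for S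
  proof -
    have "(\<Sum>k<a. S $$ (i, k) * cnj (S $$ (j, k))) = (if i = j then 1 else 0)"
      if "i \<in> {..<c}" "j \<in> {..<c}" for i j
      using arg_cong[OF S(2), of "\<lambda>M. M $$ (i, j)"] that S(1)
      by (subst (asm) mult_index) auto
    from orthonormal_extend[of "{..<c}" a "\<lambda>i k. S $$ (i, k)", OF _ this] \<open>c \<le> a\<close>
    obtain V where V: "unitary_mat a V" "\<And>i k. i < c \<Longrightarrow> k < a \<Longrightarrow> V $$ (i, k) = S $$ (i, k)"
      by auto
    have Vc: "V \<in> carrier_mat a a" using V(1) by (rule unitary_mat_carrier)
    have "J * V = S"
    proof (rule eq_matI)
      fix i k assume "i < dim_row S" "k < dim_col S"
      then have ik: "i < c" "k < a" using S by auto
      then show "(J * V) $$ (i, k) = S $$ (i, k)"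
        using V(2)[OF ik] Vc \<open>c \<le> a\<close>
        by (subst mult_index) (auto simp: J_def if_distrib[of "\<lambda>x. x * _"] cong: if_cong)
    qed (use S J Vc in auto)
    with V(1) show ?thesis by blast
  qed
  from ext[OF R] ext[OF R'] obtain V V' where
    V: "unitary_mat a V" "J * V = R" and V': "unitary_mat a V'" "J * V' = R'" by blast
  have Vc: "V \<in> carrier_mat a a" "V' \<in> carrier_mat a a"
    using V(1) V'(1) by (auto simp: unitary_mat_def)
  have "R * (mat_adjoint V * V') = J * ((V * mat_adjoint V) * V')"
    using Vc J by (simp add: V(2)[symmetric] mult_assoc_dim del: assoc_mult_mat)
  also have "\<dots> = R'" using unitary_mat_right[OF V(1)] Vc V'(2) by simp
  finally show ?thesis
    using unitary_mat_mult[OF unitary_mat_adjoint[OF V(1)] V'(1)] by blast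
qed

text \<open>\<open>P0\<close> and \<open>P1\<close> stand for square roots of reduced states. In the
  eigenbasis of \<open>X = P0 - P1\<close>, the diagonals of \<open>P1\<close> and \<open>P0\<close>
  are \<open>p i\<close> and \<open>p i + x i\<close>, both nonnegative, and the diagonal of
  \<open>P0 * P0 - P1 * P1\<close> is \<open>x i * (2 * p i + x i)\<close>, of modulus at least the
  square of \<open>x i\<close>. The sum of the squares of the \<open>x i\<close> is the left-hand
  side.\<close>

lemma powers_stormer:
  assumes W0: "unitary_mat c W0" "\<And>k. k < c \<Longrightarrow> s0 k \<ge> 0"
    and W1: "unitary_mat c W1" "\<And>k. k < c \<Longrightarrow> s1 k \<ge> 0"
    and P0: "P0 = W0 * diag_real c s0 * mat_adjoint W0"
    and P1: "P1 = W1 * diag_real c s1 * mat_adjoint W1"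
    and tr: "mat_trace (P0 * P0) = mat_trace (P1 * P1)"
  shows "\<exists>M. povm_elem c M \<and>
    hs_norm_sq (P0 - P1) \<le> 2 * (Re (mat_trace (M * (P0 * P0))) - Re (mat_trace (M * (P1 * P1))))"
proof -
  have W0c: "W0 \<in> carrier_mat c c" and W1c: "W1 \<in> carrier_mat c c"
    using W0 W1 by (auto simp: unitary_mat_def)
  have Pc: "P0 \<in> carrier_mat c c" "P1 \<in> carrier_mat c c"
    using W0c W1c by (auto simp: P0 P1)
  have ah: "mat_adjoint P0 = P0" "mat_adjoint P1 = P1"
    using W0c W1c by (simp_all add: P0 P1 mat_adjoint_mult mult_assoc_dim del: assoc_mult_mat)
  have "mat_adjoint (P0 - P1) = P0 - P1"
  proof (rule eq_matI)
    fix i j assume "i < dim_row (P0 - P1)" "j < dim_col (P0 - P1)"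
    then have ij: "i < c" "j < c" using Pc by auto
    have "cnj (P0 $$ (j, i)) = P0 $$ (i, j)" "cnj (P1 $$ (j, i)) = P1 $$ (i, j)"
      using arg_cong[OF ah(1), of "\<lambda>M. M $$ (i, j)"] arg_cong[OF ah(2), of "\<lambda>M. M $$ (i, j)"] ij Pc
      by auto
    then show "mat_adjoint (P0 - P1) $$ (i, j) = (P0 - P1) $$ (i, j)"
      using ij Pc by auto
  qed (use Pc in auto)
  moreover have "P0 - P1 \<in> carrier_mat c c"
    using Pc by auto
  ultimately obtain W x where W: "unitary_mat c W" and X: "P0 - P1 = W * diag_real c x * mat_adjoint W"
    using hermitian_spectral by blast
  have Wc: "W \<in> carrier_mat c c" using W by (rule unitary_mat_carrier)
  have WW: "mat_adjoint W * W = 1\<^sub>m c" using W by (simp add: unitary_mat_def)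
  \<comment> \<open>The matrix of \<open>P\<close> in the eigenbasis of
    \<open>P0 - P1\<close>.\<close>
  define A where "A P = mat_adjoint W * (P * W)" for P
  have Ac: "A P \<in> carrier_mat c c" if "P \<in> carrier_mat c c" for P
    using that Wc by (auto simp: A_def)
  have AA: "A P * A P = A (P * P)" if "P \<in> carrier_mat c c" for P
  proof -
    have "A P * A P = mat_adjoint W * (P * ((W * mat_adjoint W) * (P * W)))"
      using that Wc by (simp add: A_def mult_assoc_dim del: assoc_mult_mat)
    also have "\<dots> = A (P * P)"
      using that Wc unitary_mat_right[OF W] by (simp add: A_def mult_assoc_dim del: assoc_mult_mat)
    finally show ?thesis .
  qed
  have trA: "mat_trace (W * diag_real c y * mat_adjoint W * P) = (\<Sum>i<c. of_real (y i) * A P $$ (i, i))"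
    if "P \<in> carrier_mat c c" for P y
  proof -
    have "mat_trace (W * diag_real c y * mat_adjoint W * P) = mat_trace (W * (diag_real c y * (mat_adjoint W * P)))"
      using that Wc by (simp add: mult_assoc_dim del: assoc_mult_mat)
    also have "\<dots> = mat_trace (diag_real c y * (mat_adjoint W * P) * W)"
      using that Wc by (intro mat_trace_mult_comm) auto
    also have "\<dots> = mat_trace (diag_real c y * A P)"
      using that Wc by (simp add: A_def mult_assoc_dim del: assoc_mult_mat)
    also have "\<dots> = (\<Sum>i<c. of_real (y i) * A P $$ (i, i))"
      unfolding mat_trace_def using Ac[OF that]
      by (auto intro!: sum.cong simp: mult_index diag_real_def if_distrib[of "\<lambda>x. x * _"] simp del: index_mult_mat(1) cong: if_cong)
    finally show ?thesis .
  qed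
  have AX: "A (P0 - P1) = diag_real c x"
  proof -
    have "A (P0 - P1) = (mat_adjoint W * W) * (diag_real c x * (mat_adjoint W * W))"
      unfolding A_def X using Wc by (simp add: mult_assoc_dim del: assoc_mult_mat)
    then show ?thesis unfolding WW by (simp add: carrier_matI)
  qed
  have Adiff: "A P0 $$ (i, j) = A P1 $$ (i, j) + (if i = j then of_real (x i) else 0)"
    if ij: "i < c" "j < c" for i j
  proof -
    have "A (P0 - P1) = A P0 - A P1"
    proof -
      have "mat_adjoint W \<in> carrier_mat c c" by (rule carrier_matI) (use Wc in auto)
      then show ?thesis
        unfolding A_def minus_mult_distrib_mat[OF Pc Wc]
        by (rule mult_minus_distrib_mat) (use Pc Wc in auto)
    qed
    then have "A P0 $$ (i, j) - A P1 $$ (i, j) = diag_real c x $$ (i, j)"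
      using AX ij Ac Pc by (metis index_minus_mat(1) carrier_matD)
    then show ?thesis using ij by (simp add: diag_real_def diff_eq_eq add.commute split: if_splits)
  qed
  have Apos: "\<exists>p::real. p \<ge> 0 \<and> A (V * diag_real c s * mat_adjoint V) $$ (i, i) = of_real p"
    if "unitary_mat c V" "\<And>k. k < c \<Longrightarrow> s k \<ge> 0" "i < c" for V s i
  proof -
    have Vc: "V \<in> carrier_mat c c" using that(1) by (rule unitary_mat_carrier)
    define Y where "Y = mat_adjoint W * V"
    have Yc: "Y \<in> carrier_mat c c" using Wc Vc by (auto simp: Y_def)
    have "A (V * diag_real c s * mat_adjoint V) = Y * diag_real c s * mat_adjoint Y"
      using Wc Vc by (simp add: A_def Y_def mat_adjoint_mult mult_assoc_dim del: assoc_mult_mat)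
    then have "A (V * diag_real c s * mat_adjoint V) $$ (i, i) =
        (\<Sum>k<c. of_real (s k) * (Y $$ (i, k) * cnj (Y $$ (i, k))))"
      using Yc that(3) by (simp add: conj_diag_index del: index_mult_mat(1))
    also have "\<dots> = of_real (\<Sum>k<c. s k * (cmod (Y $$ (i, k)))\<^sup>2)"
      by (simp only: complex_norm_square[symmetric] of_real_sum of_real_mult)
    finally show ?thesis using that(2)
      by (intro exI[of _ "\<Sum>k<c. s k * (cmod (Y $$ (i, k)))\<^sup>2"] conjI) (auto intro!: sum_nonneg)
  qed
  have "\<exists>q::real. q \<ge> 0 \<and> A P1 $$ (i, i) = of_real q" if "i < c" for i
    unfolding P1 by (rule Apos) (use W1 that in auto)
  then obtain p where p: "\<And>i. i < c \<Longrightarrow> p i \<ge> (0::real) \<and> A P1 $$ (i, i) = of_real (p i)"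
    by metis
  have px: "p i + x i \<ge> 0" if "i < c" for i
  proof -
    have "\<exists>q::real. q \<ge> 0 \<and> A P0 $$ (i, i) = of_real q"
      unfolding P0 by (rule Apos) (use W0 that in auto)
    then obtain q where "q \<ge> (0::real)" "A P0 $$ (i, i) = of_real q" by blast
    then have "of_real (p i + x i) = (of_real q :: complex)"
      using Adiff[OF that that] p[OF that] by simp
    then have "p i + x i = q" by (simp only: of_real_eq_iff)
    then show ?thesis using \<open>q \<ge> 0\<close> by simp
  qed
  \<comment> \<open>With \<open>P0 = P1 + X\<close>, the difference of squares is
    \<open>P1 * X + X * P1 + X * X\<close>; as \<open>X\<close> is diagonal in this basis,
    \<open>f i\<close> is its \<open>i\<close>-th diagonal entry.\<close>
  define f where "f i = x i * (2 * p i + x i)" for i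
  have sq: "A (P0 * P0) $$ (i, i) = A (P1 * P1) $$ (i, i) + of_real (f i)" if i: "i < c" for i
  proof -
    have "A (P0 * P0) $$ (i, i) = (\<Sum>k<c. A P0 $$ (i, k) * A P0 $$ (k, i))"
      unfolding AA[OF Pc(1), symmetric] using Ac[OF Pc(1)] i by (subst mult_index) auto
    also have "\<dots> = (\<Sum>k<c. A P1 $$ (i, k) * A P1 $$ (k, i) +
        (if k = i then 2 * of_real (x i) * A P1 $$ (i, i) + of_real (x i) * of_real (x i) else 0))"
      using i by (intro sum.cong) (auto simp: Adiff algebra_simps)
    also have "\<dots> = A (P1 * P1) $$ (i, i) + (2 * of_real (x i) * A P1 $$ (i, i) + of_real (x i) * of_real (x i))"
      unfolding AA[OF Pc(2), symmetric] using Ac[OF Pc(2)] i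
      by (subst mult_index) (auto simp: sum.distrib)
    finally show ?thesis using p[OF i] by (simp add: f_def algebra_simps)
  qed
  have PPc: "P0 * P0 \<in> carrier_mat c c" "P1 * P1 \<in> carrier_mat c c" using Pc by auto
  have fsum: "(\<Sum>i<c. f i) = 0"
  proof -
    have one: "W * diag_real c (\<lambda>_. 1) * mat_adjoint W = 1\<^sub>m c"
    proof -
      have "diag_real c (\<lambda>_. 1) = 1\<^sub>m c" by (rule eq_matI) (auto simp: diag_real_def)
      then show ?thesis using Wc unitary_mat_right[OF W] by simp
    qed
    have "mat_trace (P0 * P0) = (\<Sum>i<c. A (P0 * P0) $$ (i, i))"
      "mat_trace (P1 * P1) = (\<Sum>i<c. A (P1 * P1) $$ (i, i))"
      using trA[OF PPc(1), of "\<lambda>_. 1"] trA[OF PPc(2), of "\<lambda>_. 1"] Pc unfolding one by auto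
    then have "(\<Sum>i<c. complex_of_real (f i)) = 0"
      using tr by (simp add: sq sum.distrib)
    then show ?thesis by (simp flip: of_real_sum)
  qed
  \<comment> \<open>The distinguisher projects onto the nonnegative eigenspace of \<open>P0 - P1\<close>. Its advantage is the
    sum of the positive \<open>f i\<close>, that is, half of the sum of all \<open>\<bar>f i\<bar>\<close> since the \<open>f i\<close> sum to \<open>0\<close>,
    and \<open>\<bar>f i\<bar> \<ge> (x i)\<^sup>2\<close>.\<close>
  define y where "y i = (if x i \<ge> 0 then 1 else 0::real)" for i
  define M where "M = W * diag_real c y * mat_adjoint W"
  have M: "povm_elem c M"
    unfolding M_def using W by (intro povm_elem_conj_diag) (auto simp: y_def)
  have "mat_trace (M * (P0 * P0)) - mat_trace (M * (P1 * P1)) = of_real (\<Sum>i<c. y i * f i)"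
    unfolding M_def trA[OF PPc(1)] trA[OF PPc(2)]
    by (simp add: sq algebra_simps sum.distrib)
  then have Mtr: "Re (mat_trace (M * (P0 * P0))) - Re (mat_trace (M * (P1 * P1))) = (\<Sum>i<c. y i * f i)"
    by (metis Re_complex_of_real minus_complex.sel(1))
  have "complex_of_real (hs_norm_sq (P0 - P1)) = mat_trace ((P0 - P1) * (P0 - P1))"
    unfolding hs_norm_sq_trace \<open>mat_adjoint (P0 - P1) = P0 - P1\<close> ..
  also have "\<dots> = (\<Sum>i<c. of_real (x i) * A (P0 - P1) $$ (i, i))"
    using trA[of "P0 - P1" x] Pc X by (metis minus_carrier_mat)
  also have "\<dots> = (\<Sum>i<c. of_real (x i) * of_real (x i))"
    by (simp add: AX diag_real_def)
  also have "\<dots> = of_real (\<Sum>i<c. x i * x i)" by simp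
  finally have "hs_norm_sq (P0 - P1) = (\<Sum>i<c. x i * x i)" by (simp only: of_real_eq_iff)
  \<comment> \<open>Since \<open>f i\<close> has the sign of \<open>x i\<close>, each term on the
    right is \<bar>\<open>f i\<close>\<bar>.\<close>
  also have "\<dots> \<le> (\<Sum>i<c. 2 * (y i * f i) - f i)"
  proof (rule sum_mono)
    fix i assume "i \<in> {..<c}"
    then have i: "p i \<ge> 0" "p i + x i \<ge> 0" using p px by auto
    show "x i * x i \<le> 2 * (y i * f i) - f i"
    proof (cases "x i \<ge> 0")
      case True
      then show ?thesis using i by (simp add: y_def f_def algebra_simps)
    next
      case False
      then have "x i * (p i + x i) \<le> 0" using i by (simp add: mult_nonpos_nonneg)
      then show ?thesis using False by (simp add: y_def f_def algebra_simps)
    qed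
  qed
  also have "\<dots> = 2 * (\<Sum>i<c. y i * f i)"
    using fsum by (simp add: sum_subtractf sum_distrib_left)
  finally show ?thesis using M Mtr by (intro exI[of _ M]) auto
qed

text \<open>\<open>B0\<close> and \<open>B1\<close> are amplitude matrices of two bipartite vectors,
  their products with their adjoints are the reduced operators, and right multiplication by
  \<open>U\<close> acts on the second register. With \<open>B0 = P0 * R0\<close> and
  \<open>B1 = P1 * R1\<close>, the unitary with \<open>R0 * U = R1\<close> gives
  \<open>B0 * U - B1 = (P0 - P1) * R1\<close>. The co-isometry \<open>R1\<close> preserves the norm,
  and \<open>powers_stormer\<close> bounds it by the advantage of a test on the first
  register.\<close>

lemma uhlmann_approx:
  assumes B: "B0 \<in> carrier_mat c a" "B1 \<in> carrier_mat c a" and "c \<le> a"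
    and eq: "hs_norm_sq B0 = hs_norm_sq B1"
  shows "\<exists>M U. povm_elem c M \<and> unitary_mat a U \<and> hs_norm_sq (B0 * U - B1) \<le>
    2 * (Re (mat_trace (M * (B0 * mat_adjoint B0))) - Re (mat_trace (M * (B1 * mat_adjoint B1))))"
proof -
  obtain W0 s0 R0 where W0: "unitary_mat c W0" "\<And>k. k < c \<Longrightarrow> s0 k \<ge> 0"
    and R0: "R0 \<in> carrier_mat c a" "R0 * mat_adjoint R0 = 1\<^sub>m c"
    and B0: "B0 = W0 * diag_real c s0 * mat_adjoint W0 * R0"
    using left_polar_decomposition[OF B(1) \<open>c \<le> a\<close>] by metis
  obtain W1 s1 R1 where W1: "unitary_mat c W1" "\<And>k. k < c \<Longrightarrow> s1 k \<ge> 0"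
    and R1: "R1 \<in> carrier_mat c a" "R1 * mat_adjoint R1 = 1\<^sub>m c"
    and B1: "B1 = W1 * diag_real c s1 * mat_adjoint W1 * R1"
    using left_polar_decomposition[OF B(2) \<open>c \<le> a\<close>] by metis
  define P0 where "P0 = W0 * diag_real c s0 * mat_adjoint W0"
  define P1 where "P1 = W1 * diag_real c s1 * mat_adjoint W1"
  have W0c: "W0 \<in> carrier_mat c c" and W1c: "W1 \<in> carrier_mat c c"
    using W0 W1 by (auto simp: unitary_mat_def)
  have Pc: "P0 \<in> carrier_mat c c" "P1 \<in> carrier_mat c c"
    using W0c W1c by (auto simp: P0_def P1_def)
  have ah: "mat_adjoint P0 = P0" "mat_adjoint P1 = P1"
    using W0c W1c by (simp_all add: P0_def P1_def mat_adjoint_mult mult_assoc_dim del: assoc_mult_mat)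
  have BB: "(P * R) * mat_adjoint (P * R) = P * mat_adjoint P"
    if "P \<in> carrier_mat c c" "R \<in> carrier_mat c a" "R * mat_adjoint R = 1\<^sub>m c" for P R :: "complex mat"
  proof -
    have "(P * R) * mat_adjoint (P * R) = P * ((R * mat_adjoint R) * mat_adjoint P)"
      using that(1,2) by (simp add: mat_adjoint_mult mult_assoc_dim del: assoc_mult_mat)
    then show ?thesis using that by simp
  qed
  have BB0: "B0 * mat_adjoint B0 = P0 * P0" and BB1: "B1 * mat_adjoint B1 = P1 * P1"
    using BB[OF Pc(1) R0] BB[OF Pc(2) R1] ah by (auto simp: B0 B1 P0_def P1_def)
  have "mat_trace (P0 * P0) = mat_trace (P1 * P1)"
    using eq hs_norm_sq_trace[of B0] hs_norm_sq_trace[of B1] BB0 BB1 by simp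
  from powers_stormer[OF W0 W1 P0_def P1_def this] obtain M where M: "povm_elem c M"
    "hs_norm_sq (P0 - P1) \<le> 2 * (Re (mat_trace (M * (P0 * P0))) - Re (mat_trace (M * (P1 * P1))))"
    by blast
  obtain U where U: "unitary_mat a U" "R0 * U = R1"
    using coisometries_unitarily_equivalent[OF R0 R1 \<open>c \<le> a\<close>] by blast
  have Uc: "U \<in> carrier_mat a a" using U(1) by (rule unitary_mat_carrier)
  have "B0 * U - B1 = P0 * R1 - P1 * R1"
    using Pc R0 Uc U(2) by (simp add: B0 B1 P0_def[symmetric] P1_def[symmetric] mult_assoc_dim del: assoc_mult_mat)
  also have "\<dots> = (P0 - P1) * R1" using Pc R1 by (simp add: minus_mult_distrib_mat)
  finally have "complex_of_real (hs_norm_sq (B0 * U - B1)) = of_real (hs_norm_sq (P0 - P1))"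
    using BB[OF minus_carrier_mat[OF Pc(2), of P0] R1] by (simp add: hs_norm_sq_trace)
  then have "hs_norm_sq (B0 * U - B1) = hs_norm_sq (P0 - P1)" by (simp only: of_real_eq_iff)
  then show ?thesis using M U(1)
    by (intro exI[of _ M] exI[of _ U]) (simp add: BB0 BB1)
qed

section \<open>Bipartite states and the bit-flip attack\<close>

lemma index_mult_add_less:
  fixes i j :: nat
  assumes "i < d" "j < k"
  shows "i * k + j < d * k"
proof -
  have "i * k + j < Suc i * k" using assms by simp
  also have "\<dots> \<le> d * k" using assms by (intro mult_right_mono) auto
  finally show ?thesis .
qed

lemma sum_lessThan_mult:
  fixes f :: "nat \<Rightarrow> 'a :: comm_monoid_add"
  shows "(\<Sum>m<d * k. f m) = (\<Sum>i<d. \<Sum>j<k. f (i * k + j))"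
proof -
  have "(\<Sum>j<k. f (i * k + j)) = sum f {i * k..<i * k + k}" for i
    by (rule sum.reindex_bij_witness[of _ "\<lambda>m. m - i * k" "\<lambda>j. i * k + j"]) auto
  then show ?thesis by (simp add: sum.nat_group)
qed

lemma kron_dim [simp]:
  "dim_row (kron A B) = dim_row A * dim_row B" "dim_col (kron A B) = dim_col A * dim_col B"
  by (simp_all add: kron_def)

lemma kron_index:
  assumes "i < dim_row A" "j < dim_row B" "i' < dim_col A" "j' < dim_col B"
  shows "kron A B $$ (i * dim_row B + j, i' * dim_col B + j') = A $$ (i, i') * B $$ (j, j')"
  using assms by (simp add: kron_def index_mult_add_less)

text \<open>For \<open>v\<close> on a space \<open>X \<otimes> Y\<close> with \<open>dim X = d\<close> and \<open>dim Y = k\<close>, this is the unnormalised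
  component \<open>(I \<otimes> \<langle>j|) v\<close>.\<close>
definition slice :: "nat \<Rightarrow> nat \<Rightarrow> nat \<Rightarrow> complex Matrix.vec \<Rightarrow> complex Matrix.vec" where
  "slice d k j v = Matrix.vec d (\<lambda>i. v $ (i * k + j))"

lemma slice_carrier [simp]: "slice d k j v \<in> carrier_vec d"
  by (simp add: slice_def)

lemma slice_dim [simp]: "dim_vec (slice d k j v) = d"
  by (simp add: slice_def)

lemma kron_one_mult_vec:
  assumes "M \<in> carrier_mat d d" "v \<in> carrier_vec (d * k)" "i < d" "j < k"
  shows "(kron M (1\<^sub>m k) *\<^sub>v v) $ (i * k + j) = (M *\<^sub>v slice d k j v) $ i"
proof -
  have "(kron M (1\<^sub>m k) *\<^sub>v v) $ (i * k + j) =
      (\<Sum>m<d * k. kron M (1\<^sub>m k) $$ (i * k + j, m) * v $ m)"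
    using assms by (subst mult_vec_index) (auto simp: index_mult_add_less)
  also have "\<dots> = (\<Sum>i'<d. \<Sum>j'<k. M $$ (i, i') * (if j = j' then 1 else 0) * v $ (i' * k + j'))"
    unfolding sum_lessThan_mult
  proof (intro sum.cong refl)
    fix i' j' assume "i' \<in> {..<d}" "j' \<in> {..<k}"
    then have "kron M (1\<^sub>m k) $$ (i * k + j, i' * k + j') = M $$ (i, i') * 1\<^sub>m k $$ (j, j')"
      using kron_index[of i M j "1\<^sub>m k" i' j'] assms by simp
    then show "kron M (1\<^sub>m k) $$ (i * k + j, i' * k + j') * v $ (i' * k + j') =
        M $$ (i, i') * (if j = j' then 1 else 0) * v $ (i' * k + j')"
      using assms \<open>j' \<in> {..<k}\<close> by simp
  qed
  also have "\<dots> = (\<Sum>i'<d. M $$ (i, i') * v $ (i' * k + j))"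
    using assms by (intro sum.cong refl) (simp add: if_distrib[of "\<lambda>x. _ * x * _"] cong: if_cong)
  also have "\<dots> = (M *\<^sub>v slice d k j v) $ i"
    using assms by (subst mult_vec_index) (auto simp: slice_def)
  finally show ?thesis .
qed

lemma cscalar_prod_slices:
  assumes "w \<in> carrier_vec (d * k)"
  shows "v \<bullet>c w = (\<Sum>j<k. slice d k j v \<bullet>c slice d k j w)"
proof -
  have "v \<bullet>c w = (\<Sum>i<d. \<Sum>j<k. v $ (i * k + j) * cnj (w $ (i * k + j)))"
    using assms by (simp add: cscalar_prod_sum sum_lessThan_mult)
  also have "\<dots> = (\<Sum>j<k. slice d k j v \<bullet>c slice d k j w)"
    by (subst sum.swap) (simp add: cscalar_prod_sum slice_def)
  finally show ?thesis .
qed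

lemma quadratic_form_kron_one:
  assumes "M \<in> carrier_mat d d" "v \<in> carrier_vec (d * k)"
  shows "(kron M (1\<^sub>m k) *\<^sub>v v) \<bullet>c v = (\<Sum>j<k. (M *\<^sub>v slice d k j v) \<bullet>c slice d k j v)"
proof -
  have "slice d k j (kron M (1\<^sub>m k) *\<^sub>v v) = M *\<^sub>v slice d k j v" if "j < k" for j
    by (rule eq_vecI) (use kron_one_mult_vec[OF assms _ that] assms in \<open>auto simp: slice_def\<close>)
  then show ?thesis by (subst cscalar_prod_slices[OF assms(2)]) simp
qed

lemma acc_prob_kron_one:
  assumes "M \<in> carrier_mat d d" "v \<in> carrier_vec (d * k)"
  shows "acc_prob (kron M (1\<^sub>m k)) v = (\<Sum>j<k. acc_prob M (slice d k j v))"
  by (simp add: acc_prob_def quadratic_form_kron_one[OF assms])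

lemma psd_kron_one:
  assumes "psd d M"
  shows "psd (d * k) (kron M (1\<^sub>m k))"
proof -
  have M: "M \<in> carrier_mat d d" using assms by (simp add: psd_def)
  have "kron M (1\<^sub>m k) \<in> carrier_mat (d * k) (d * k)"
    by (rule carrier_matI) (use M in auto)
  then show ?thesis
    using assms unfolding psd_def
    by (auto simp: quadratic_form_kron_one[OF M] intro!: sum_in_Reals sum_nonneg)
qed

lemma one_minus_kron_one:
  assumes "M \<in> carrier_mat d d"
  shows "1\<^sub>m (d * k) - kron M (1\<^sub>m k) = kron (1\<^sub>m d - M) (1\<^sub>m k)"
proof (rule eq_matI)
  fix m n assume "m < dim_row (kron (1\<^sub>m d - M) (1\<^sub>m k))" "n < dim_col (kron (1\<^sub>m d - M) (1\<^sub>m k))"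
  then have mn: "m < d * k" "n < d * k" using assms by auto
  then have "k > 0" by (cases k) auto
  have "m = n \<longleftrightarrow> m div k = n div k \<and> m mod k = n mod k"
    by (metis div_mult_mod_eq)
  moreover have "m div k < d" "n div k < d"
    using mn by (auto simp: less_mult_imp_div_less)
  ultimately show "(1\<^sub>m (d * k) - kron M (1\<^sub>m k)) $$ (m, n) = kron (1\<^sub>m d - M) (1\<^sub>m k) $$ (m, n)"
    using mn assms \<open>k > 0\<close> by (auto simp: kron_def)
qed (use assms in auto)

lemma kron_one_one: "kron (1\<^sub>m c) (1\<^sub>m a) = 1\<^sub>m (c * a)"
proof (rule eq_matI)
  fix m n assume "m < dim_row (1\<^sub>m (c * a) :: complex mat)" "n < dim_col (1\<^sub>m (c * a) :: complex mat)"
  then have mn: "m < c * a" "n < c * a" by auto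
  then have "a > 0" by (cases a) auto
  have "m = n \<longleftrightarrow> m div a = n div a \<and> m mod a = n mod a"
    by (metis div_mult_mod_eq)
  moreover have "m div a < c" "n div a < c"
    using mn by (auto simp: less_mult_imp_div_less)
  ultimately show "kron (1\<^sub>m c) (1\<^sub>m a) $$ (m, n) = 1\<^sub>m (c * a) $$ (m, n)"
    using mn \<open>a > 0\<close> by (auto simp: kron_def)
qed auto

lemma povm_elem_kron_one:
  assumes "povm_elem d M"
  shows "povm_elem (d * k) (kron M (1\<^sub>m k))"
proof -
  have "M \<in> carrier_mat d d" using assms by (simp add: povm_elem_def psd_def)
  from one_minus_kron_one[OF this] show ?thesis
    using assms psd_kron_one by (simp add: povm_elem_def)
qed

lemma povm_elem_carrier: "povm_elem d M \<Longrightarrow> M \<in> carrier_mat d d"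
  by (simp add: povm_elem_def psd_def)

text \<open>Associativity of the tensor product, by comparing mixed-radix digits. It lets a test on
  C be read on (C R) E, where superpositions split into honest states, or on C (R E), where
  Uhlmann's theorem applies.\<close>

lemma kron_kron_one:
  assumes "M \<in> carrier_mat d d"
  shows "kron (kron M (1\<^sub>m r)) (1\<^sub>m k) = kron M (1\<^sub>m (r * k))"
proof (rule eq_matI)
  fix m n assume "m < dim_row (kron M (1\<^sub>m (r * k)))" "n < dim_col (kron M (1\<^sub>m (r * k)))"
  then have mn: "m < d * (r * k)" "n < d * (r * k)" using assms by auto
  then have pos: "k > 0" "r > 0" by (auto intro!: Nat.gr0I)
  have lt: "m div k < d * r" "n div k < d * r"
    using mn by (auto simp: less_mult_imp_div_less mult.assoc)
  \<comment> \<open>The remainder modulo \<open>r * k\<close> is composed of the digits for R and E,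
    so two remainders agree iff both digits do.\<close>
  have e: "l mod (r * k) = k * (l div k mod r) + l mod k" for l
    using mod_mult2_eq[of l k r] by (simp add: mult.commute)
  have "m mod (r * k) = n mod (r * k) \<longleftrightarrow> m mod k = n mod k \<and> m div k mod r = n div k mod r"
    unfolding e using pos
    by (metis add_diff_cancel_right' div_mult_self4 mod_less_divisor mod_mult_self4 mod_mod_trivial
        nonzero_mult_div_cancel_left not_gr_zero)
  moreover have "l div k div r = l div (r * k)" for l
    by (simp add: div_mult2_eq mult.commute)
  ultimately show "kron (kron M (1\<^sub>m r)) (1\<^sub>m k) $$ (m, n) = kron M (1\<^sub>m (r * k)) $$ (m, n)"
    using mn lt assms pos by (auto simp: kron_def mult.assoc)
qed (use assms in auto)

section \<open>Acceptance probabilities as quadratic forms\<close>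

lemma acc_prob_sum:
  assumes "M \<in> carrier_mat d d" "v \<in> carrier_vec d"
  shows "acc_prob M v = Re (\<Sum>i<d. \<Sum>j<d. M $$ (i, j) * v $ j * cnj (v $ i))"
proof -
  have "(M *\<^sub>v v) \<bullet>c v = (\<Sum>i<d. (\<Sum>j<d. M $$ (i, j) * v $ j) * cnj (v $ i))"
    unfolding cscalar_prod_sum using assms
    by (intro sum.cong) (auto simp: mult_vec_index simp del: index_mult_mat_vec)
  then show ?thesis by (simp add: acc_prob_def sum_distrib_right)
qed

lemma acc_prob_smult:
  assumes "M \<in> carrier_mat d d" "v \<in> carrier_vec d"
  shows "acc_prob M (complex_of_real s \<cdot>\<^sub>v v) = s\<^sup>2 * acc_prob M v"
proof -
  have "(\<Sum>i<d. \<Sum>j<d. M $$ (i, j) * (complex_of_real s \<cdot>\<^sub>v v) $ j * cnj ((complex_of_real s \<cdot>\<^sub>v v) $ i)) =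
    of_real (s\<^sup>2) * (\<Sum>i<d. \<Sum>j<d. M $$ (i, j) * v $ j * cnj (v $ i))"
    using assms(2) unfolding sum_distrib_left
    by (intro sum.cong refl) (auto simp: power2_eq_square mult_ac)
  then show ?thesis
    using assms by (subst (1 2) acc_prob_sum[of _ d]) (auto simp del: of_real_power)
qed

lemma acc_prob_nonneg: "povm_elem d M \<Longrightarrow> v \<in> carrier_vec d \<Longrightarrow> 0 \<le> acc_prob M v"
  by (simp add: povm_elem_def psd_def acc_prob_def)

lemma acc_prob_le_norm:
  assumes "povm_elem d M" "v \<in> carrier_vec d"
  shows "acc_prob M v \<le> Re (v \<bullet>c v)"
proof -
  have M: "M \<in> carrier_mat d d" using assms(1) by (rule povm_elem_carrier)
  have "(1\<^sub>m d - M) *\<^sub>v v = v - M *\<^sub>v v"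
    using M assms(2) by (simp add: minus_mult_distrib_mat_vec[of _ d d])
  then have "((1\<^sub>m d - M) *\<^sub>v v) \<bullet>c v = v \<bullet>c v - (M *\<^sub>v v) \<bullet>c v"
    using M assms(2) by (simp add: minus_scalar_prod_distrib[of _ d])
  then show ?thesis
    using assms unfolding povm_elem_def psd_def acc_prob_def by force
qed

lemma acc_prob_le_one: "povm_elem d M \<Longrightarrow> qstate d v \<Longrightarrow> acc_prob M v \<le> 1"
  using acc_prob_le_norm[of d M v] by (simp add: qstate_def)

text \<open>A Cauchy-Schwarz estimate for the form of \<open>M\<close>, in the version with a free
  parameter \<open>s\<close> that balances the two error terms and avoids square roots.\<close>

lemma acc_prob_perturb:
  assumes M: "povm_elem d M" and v: "qstate d v" and u: "u \<in> carrier_vec d" and s: "s > 0"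
  shows "acc_prob M u \<ge> acc_prob M v - s - Re ((u - v) \<bullet>c (u - v)) / s"
proof -
  have vc: "v \<in> carrier_vec d" using v by (simp add: qstate_def)
  have Mc: "M \<in> carrier_mat d d" using M by (rule povm_elem_carrier)
  define w where "w = u - v"
  have wc: "w \<in> carrier_vec d" using u vc by (simp add: w_def)
  \<comment> \<open>The explicit factor 1 makes \<open>u\<close> the case \<open>t = 1\<close> of
    the expansion below.\<close>
  have uw: "u = complex_of_real 1 \<cdot>\<^sub>v v + w" using u vc by (auto simp: w_def)
  define X where "X = Re (\<Sum>i<d. \<Sum>j<d. M $$ (i, j) * (v $ j * cnj (w $ i) + w $ j * cnj (v $ i)))"
  have expand: "acc_prob M (complex_of_real t \<cdot>\<^sub>v v + w) = t\<^sup>2 * acc_prob M v + t * X + acc_prob M w" for t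
  proof -
    let ?z = "complex_of_real t \<cdot>\<^sub>v v + w"
    have "(\<Sum>i<d. \<Sum>j<d. M $$ (i, j) * ?z $ j * cnj (?z $ i)) =
      (\<Sum>i<d. \<Sum>j<d. of_real (t\<^sup>2) * (M $$ (i, j) * v $ j * cnj (v $ i))
        + of_real t * (M $$ (i, j) * (v $ j * cnj (w $ i) + w $ j * cnj (v $ i)))
        + M $$ (i, j) * w $ j * cnj (w $ i))"
      using vc wc by (intro sum.cong refl) (auto simp: algebra_simps power2_eq_square)
    also have "\<dots> = of_real (t\<^sup>2) * (\<Sum>i<d. \<Sum>j<d. M $$ (i, j) * v $ j * cnj (v $ i))
        + of_real t * (\<Sum>i<d. \<Sum>j<d. M $$ (i, j) * (v $ j * cnj (w $ i) + w $ j * cnj (v $ i)))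
        + (\<Sum>i<d. \<Sum>j<d. M $$ (i, j) * w $ j * cnj (w $ i))"
      by (simp only: sum.distrib sum_distrib_left)
    finally show ?thesis
      using vc wc Mc by (subst (1 2 3) acc_prob_sum[of _ d]) (auto simp: X_def simp del: of_real_power)
  qed
  have a: "acc_prob M v \<le> 1" "acc_prob M w \<le> Re (w \<bullet>c w)" "acc_prob M w \<ge> 0"
    using acc_prob_le_one[OF M v] acc_prob_le_norm[OF M wc] acc_prob_nonneg[OF M wc] by auto
  \<comment> \<open>Positivity at \<open>s v + w\<close> bounds the cross term \<open>X\<close> from below.\<close>
  have "0 \<le> s\<^sup>2 * acc_prob M v + s * X + acc_prob M w"
    unfolding expand[of s, symmetric] using M vc wc by (intro acc_prob_nonneg[of d]) auto
  then have "0 \<le> (s\<^sup>2 * acc_prob M v + s * X + acc_prob M w) / s" using s by simp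
  then have "- X \<le> s * acc_prob M v + acc_prob M w / s"
    using s by (simp add: field_simps power2_eq_square)
  also have "\<dots> \<le> s * 1 + Re (w \<bullet>c w) / s"
    using a s by (intro add_mono mult_left_mono divide_right_mono) auto
  finally show ?thesis
    using expand[of 1] a(3) unfolding uw[symmetric] by (simp add: w_def)
qed

section \<open>Bipartite vectors as matrices of amplitudes\<close>

definition amplitudes :: "nat \<Rightarrow> nat \<Rightarrow> complex Matrix.vec \<Rightarrow> complex mat" where
  "amplitudes c a v = Matrix.mat c a (\<lambda>(i, j). v $ (i * a + j))"

lemma amplitudes_carrier [simp]: "amplitudes c a v \<in> carrier_mat c a"
  by (simp add: amplitudes_def)

lemma amplitudes_dim [simp]: "dim_row (amplitudes c a v) = c" "dim_col (amplitudes c a v) = a"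
  by (simp_all add: amplitudes_def)

text \<open>The amplitude matrix times its adjoint is the reduced operator on the first factor, and
  a test on that factor sees only this operator.\<close>

lemma acc_prob_kron_one_trace:
  assumes "M \<in> carrier_mat c c" "v \<in> carrier_vec (c * a)"
  shows "acc_prob (kron M (1\<^sub>m a)) v =
    Re (mat_trace (M * (amplitudes c a v * mat_adjoint (amplitudes c a v))))"
proof -
  let ?B = "amplitudes c a v"
  have "mat_trace (M * (?B * mat_adjoint ?B)) = (\<Sum>i<c. (M * (?B * mat_adjoint ?B)) $$ (i, i))"
    using assms by (simp add: mat_trace_def)
  also have "\<dots> = (\<Sum>i<c. \<Sum>k<c. M $$ (i, k) * (?B * mat_adjoint ?B) $$ (k, i))"
    using assms by (intro sum.cong refl, subst mult_index) auto
  also have "\<dots> = (\<Sum>i<c. \<Sum>k<c. \<Sum>j<a. M $$ (i, k) * v $ (k * a + j) * cnj (v $ (i * a + j)))"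
    using assms by (intro sum.cong refl, subst mult_index)
      (auto simp: amplitudes_def sum_distrib_left mult.assoc)
  also have "\<dots> = (\<Sum>i<c. \<Sum>j<a. \<Sum>k<c. M $$ (i, k) * v $ (k * a + j) * cnj (v $ (i * a + j)))"
    by (rule sum.cong[OF refl]) (rule sum.swap)
  also have "\<dots> = (\<Sum>j<a. \<Sum>i<c. \<Sum>k<c. M $$ (i, k) * v $ (k * a + j) * cnj (v $ (i * a + j)))"
    by (rule sum.swap)
  finally show ?thesis
    using assms(1) by (simp add: acc_prob_kron_one[OF assms] acc_prob_sum[of M c] slice_def)
qed

lemma hs_norm_sq_amplitudes:
  assumes "v \<in> carrier_vec (c * a)"
  shows "hs_norm_sq (amplitudes c a v) = Re (v \<bullet>c v)"
proof -
  have "v \<bullet>c v = (\<Sum>i<c. \<Sum>j<a. of_real ((cmod (v $ (i * a + j)))\<^sup>2))"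
    using assms by (simp add: cscalar_prod_sum sum_lessThan_mult complex_norm_square[symmetric])
  then show ?thesis by (simp add: hs_norm_sq_def amplitudes_def)
qed

lemma amplitudes_minus:
  assumes "u \<in> carrier_vec (c * a)" "v \<in> carrier_vec (c * a)"
  shows "amplitudes c a (u - v) = amplitudes c a u - amplitudes c a v"
  by (rule eq_matI) (use assms in \<open>auto simp: amplitudes_def index_mult_add_less\<close>)

text \<open>Vectors of the second factor appear as rows of the amplitude matrix, hence the
  transpose. For this reason the attack applies the transpose of the unitary from
  \<open>uhlmann_approx\<close>.\<close>

lemma amplitudes_kron_one:
  assumes "U \<in> carrier_mat a a" "v \<in> carrier_vec (c * a)"
  shows "amplitudes c a (kron (1\<^sub>m c) U *\<^sub>v v) = amplitudes c a v * transpose_mat U"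
proof (rule eq_matI)
  fix i j assume "i < dim_row (amplitudes c a v * transpose_mat U)"
    "j < dim_col (amplitudes c a v * transpose_mat U)"
  then have ij: "i < c" "j < a" using assms by auto
  have "amplitudes c a (kron (1\<^sub>m c) U *\<^sub>v v) $$ (i, j) =
      (\<Sum>m<c * a. kron (1\<^sub>m c) U $$ (i * a + j, m) * v $ m)"
    unfolding amplitudes_def using ij assms
    by (simp add: mult_vec_index index_mult_add_less del: index_mult_mat_vec)
  also have "\<dots> = (\<Sum>i'<c. \<Sum>j'<a. (if i = i' then 1 else 0) * (U $$ (j, j') * v $ (i' * a + j')))"
    unfolding sum_lessThan_mult
  proof (intro sum.cong refl)
    fix i' j' assume ij': "i' \<in> {..<c}" "j' \<in> {..<a}"
    then have "kron (1\<^sub>m c) U $$ (i * a + j, i' * a + j') = 1\<^sub>m c $$ (i, i') * U $$ (j, j')"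
      using kron_index[of i "1\<^sub>m c" j U i' j'] assms ij by simp
    then show "kron (1\<^sub>m c) U $$ (i * a + j, i' * a + j') * v $ (i' * a + j') =
        (if i = i' then 1 else 0) * (U $$ (j, j') * v $ (i' * a + j'))"
      using ij ij' by simp
  qed
  also have "\<dots> = (\<Sum>i'<c. (if i = i' then 1 else 0) * (\<Sum>j'<a. U $$ (j, j') * v $ (i' * a + j')))"
    by (simp only: sum_distrib_left)
  also have "\<dots> = (\<Sum>j'<a. U $$ (j, j') * v $ (i * a + j'))"
    using ij by (simp add: if_distrib[of "\<lambda>x. x * _"] cong: if_cong)
  also have "\<dots> = (amplitudes c a v * transpose_mat U) $$ (i, j)"
    using ij assms by (subst mult_index) (auto simp: amplitudes_def mult.commute)
  finally show "amplitudes c a (kron (1\<^sub>m c) U *\<^sub>v v) $$ (i, j) =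
      (amplitudes c a v * transpose_mat U) $$ (i, j)" .
qed (use assms in auto)

lemma unitary_mat_transpose:
  assumes "unitary_mat d U"
  shows "unitary_mat d (transpose_mat U)"
proof (rule unitary_matI_right)
  have U: "U \<in> carrier_mat d d" using assms by (rule unitary_mat_carrier)
  then show "transpose_mat U \<in> carrier_mat d d" by simp
  show "transpose_mat U * mat_adjoint (transpose_mat U) = 1\<^sub>m d"
  proof (rule eq_matI)
    fix i j assume "i < dim_row (1\<^sub>m d :: complex mat)" "j < dim_col (1\<^sub>m d :: complex mat)"
    then have ij: "i < d" "j < d" by auto
    have "(transpose_mat U * mat_adjoint (transpose_mat U)) $$ (i, j) = (\<Sum>k<d. U $$ (k, i) * cnj (U $$ (k, j)))"
      using ij U by (subst mult_index) auto
    also have "\<dots> = (mat_adjoint U * U) $$ (j, i)"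
      using ij U by (subst mult_index) (auto simp: mult.commute)
    also have "\<dots> = 1\<^sub>m d $$ (i, j)"
      using assms ij by (simp add: unitary_mat_def)
    finally show "(transpose_mat U * mat_adjoint (transpose_mat U)) $$ (i, j) = 1\<^sub>m d $$ (i, j)" .
  qed (use U in auto)
qed

text \<open>A purification of the mixture of the \<open>psi j\<close> with weights
  \<open>w j\<close>. The index register is the less significant digit \<open>m mod k\<close>, in
  agreement with \<open>kron M (1\<^sub>m k)\<close> and \<open>slice\<close>.\<close>

definition superpose :: "nat \<Rightarrow> nat \<Rightarrow> (nat \<Rightarrow> real) \<Rightarrow> (nat \<Rightarrow> complex Matrix.vec) \<Rightarrow> complex Matrix.vec" where
  "superpose d k w psi = Matrix.vec (d * k) (\<lambda>m. of_real (sqrt (w (m mod k))) * psi (m mod k) $ (m div k))"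

lemma superpose_carrier [simp]: "superpose d k w psi \<in> carrier_vec (d * k)"
  by (simp add: superpose_def)

lemma slice_superpose:
  assumes "j < k" "psi j \<in> carrier_vec d"
  shows "slice d k j (superpose d k w psi) = of_real (sqrt (w j)) \<cdot>\<^sub>v psi j"
  by (rule eq_vecI) (use assms in \<open>auto simp: slice_def superpose_def index_mult_add_less\<close>)

lemma acc_prob_kron_one_superpose:
  assumes "M \<in> carrier_mat d d" "\<And>j. j < k \<Longrightarrow> psi j \<in> carrier_vec d" "\<And>j. j < k \<Longrightarrow> w j \<ge> 0"
  shows "acc_prob (kron M (1\<^sub>m k)) (superpose d k w psi) = (\<Sum>j<k. w j * acc_prob M (psi j))"
  using assms by (simp add: acc_prob_kron_one[of M d] slice_superpose acc_prob_smult[of M d])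

lemma qstate_superpose:
  assumes psi: "\<And>j. j < k \<Longrightarrow> qstate d (psi j)" and w: "\<And>j. j < k \<Longrightarrow> w j \<ge> 0" "(\<Sum>j<k. w j) = 1"
  shows "qstate (d * k) (superpose d k w psi)"
proof -
  have "slice d k j (superpose d k w psi) \<bullet>c slice d k j (superpose d k w psi) = of_real (w j)"
    if "j < k" for j
  proof -
    have p: "psi j \<in> carrier_vec d" "psi j \<bullet>c psi j = 1" using psi[OF that] by (auto simp: qstate_def)
    have "(of_real s \<cdot>\<^sub>v psi j) \<bullet>c (of_real s \<cdot>\<^sub>v psi j) = of_real (s * s) * (psi j \<bullet>c psi j)" for s
      using p(1) unfolding cscalar_prod_sum sum_distrib_left
      by (intro sum.cong) (auto simp: mult_ac)
    then show ?thesis using p slice_superpose[where psi = psi, OF that p(1)] w(1)[OF that]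
      by (simp flip: of_real_mult)
  qed
  then have "superpose d k w psi \<bullet>c superpose d k w psi = 1"
    using w(2) by (subst cscalar_prod_slices[of _ d k]) (simp_all flip: of_real_sum)
  then show ?thesis by (simp add: qstate_def)
qed

text \<open>\<open>phi\<close> is the purified mixture for \<open>False\<close>, so the identity
  opens it like an honest commitment. By \<open>uhlmann_approx\<close>, \<open>U\<close> moves it to
  squared distance at most twice the advantage of \<open>M\<close> from the purification for
  \<open>True\<close>, and \<open>acc_prob_perturb\<close> converts this into the stated loss.
  \<open>M\<close> is chosen before \<open>L\<close> and acts on C only, so that hiding applies to
  it.\<close>

lemma bit_flip_attack:
  fixes psi :: "bool \<Rightarrow> nat \<Rightarrow> complex Matrix.vec"
  assumes psi: "\<And>b j. j < k \<Longrightarrow> qstate (c * r) (psi b j)"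
    and w: "\<And>j. j < k \<Longrightarrow> w j \<ge> 0" "(\<Sum>j<k. w j) = 1" and "c \<le> k"
  shows "\<exists>phi U M. qstate (c * (r * k)) phi \<and> unitary_mat (r * k) U \<and> povm_elem c M \<and>
    (\<forall>L. povm_elem (c * r) L \<longrightarrow>
      acc_prob (kron L (1\<^sub>m k)) (kron (1\<^sub>m c) (1\<^sub>m (r * k)) *\<^sub>v phi) = (\<Sum>j<k. w j * acc_prob L (psi False j))) \<and>
    (\<forall>L s. povm_elem (c * r) L \<longrightarrow> s > 0 \<longrightarrow>
      acc_prob (kron L (1\<^sub>m k)) (kron (1\<^sub>m c) U *\<^sub>v phi) \<ge> (\<Sum>j<k. w j * acc_prob L (psi True j)) - s
        - 2 * ((\<Sum>j<k. w j * acc_prob (kron M (1\<^sub>m r)) (psi False j))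
             - (\<Sum>j<k. w j * acc_prob (kron M (1\<^sub>m r)) (psi True j))) / s)"
proof -
  let ?a = "r * k"
  define phi where "phi b = superpose (c * r) k w (psi b)" for b
  have psic: "psi b j \<in> carrier_vec (c * r)" if "j < k" for b j
    using psi[OF that] by (simp add: qstate_def)
  have q: "qstate (c * r * k) (phi b)" for b
    unfolding phi_def using psi w by (intro qstate_superpose)
  then have q': "qstate (c * ?a) (phi b)" for b by (simp add: mult.assoc)
  have pc: "phi b \<in> carrier_vec (c * ?a)" for b using q' by (simp add: qstate_def)
  \<comment> \<open>A zero-dimensional space has no unit vector. With \<open>c \<le> k\<close> this
    yields \<open>c \<le> r * k\<close>, as the polar decomposition requires.\<close>
  have "r > 0"
  proof (rule Nat.gr0I)
    assume "r = 0"
    then show False using q[of True] by (auto simp: qstate_def cscalar_prod_sum)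
  qed
  then have ca: "c \<le> ?a" using \<open>c \<le> k\<close> by (cases r) auto
  have "hs_norm_sq (amplitudes c ?a (phi b)) = 1" for b
    using hs_norm_sq_amplitudes[OF pc] q' by (simp add: qstate_def)
  then obtain M U where M: "povm_elem c M" and U: "unitary_mat ?a U" and
    h: "hs_norm_sq (amplitudes c ?a (phi False) * U - amplitudes c ?a (phi True)) \<le>
      2 * (Re (mat_trace (M * (amplitudes c ?a (phi False) * mat_adjoint (amplitudes c ?a (phi False)))))
         - Re (mat_trace (M * (amplitudes c ?a (phi True) * mat_adjoint (amplitudes c ?a (phi True))))))"
    using uhlmann_approx[OF amplitudes_carrier amplitudes_carrier ca, of "phi False" "phi True"] by auto
  have Mc: "M \<in> carrier_mat c c" using M by (rule povm_elem_carrier)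
  have Uc: "U \<in> carrier_mat ?a ?a" using U by (rule unitary_mat_carrier)
  define u where "u = kron (1\<^sub>m c) (transpose_mat U) *\<^sub>v phi False"
  have uc: "u \<in> carrier_vec (c * ?a)" using Uc by (simp add: u_def carrier_vecI)
  have acc: "acc_prob (kron L (1\<^sub>m k)) (phi b) = (\<Sum>j<k. w j * acc_prob L (psi b j))"
    if "L \<in> carrier_mat (c * r) (c * r)" for L b
    unfolding phi_def using that psic w by (intro acc_prob_kron_one_superpose)
  have krc: "kron M (1\<^sub>m r) \<in> carrier_mat (c * r) (c * r)" using Mc by (auto intro!: carrier_matI)
  have "Re ((u - phi True) \<bullet>c (u - phi True)) = hs_norm_sq (amplitudes c ?a (u - phi True))"
    using uc pc by (simp add: hs_norm_sq_amplitudes)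
  also have "\<dots> = hs_norm_sq (amplitudes c ?a (phi False) * U - amplitudes c ?a (phi True))"
    using uc pc Uc amplitudes_kron_one[of "transpose_mat U" ?a "phi False" c]
    by (simp add: amplitudes_minus u_def)
  also have "\<dots> \<le> 2 * (acc_prob (kron M (1\<^sub>m ?a)) (phi False) - acc_prob (kron M (1\<^sub>m ?a)) (phi True))"
    using h by (simp add: acc_prob_kron_one_trace[OF Mc pc])
  also have "\<dots> = 2 * ((\<Sum>j<k. w j * acc_prob (kron M (1\<^sub>m r)) (psi False j))
      - (\<Sum>j<k. w j * acc_prob (kron M (1\<^sub>m r)) (psi True j)))"
    by (simp only: kron_kron_one[OF Mc, symmetric] acc[OF krc])
  finally have close: "Re ((u - phi True) \<bullet>c (u - phi True)) \<le> \<dots>" .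
  have id: "kron (1\<^sub>m c) (1\<^sub>m ?a) *\<^sub>v phi False = phi False"
    using pc by (simp add: kron_one_one)
  show ?thesis
  proof (rule exI[of _ "phi False"], rule exI[of _ "transpose_mat U"], rule exI[of _ M], intro conjI allI impI)
    fix L and s :: real assume L: "povm_elem (c * r) L" and s: "s > 0"
    have "acc_prob (kron L (1\<^sub>m k)) u \<ge> acc_prob (kron L (1\<^sub>m k)) (phi True) - s
        - Re ((u - phi True) \<bullet>c (u - phi True)) / s"
      using povm_elem_kron_one[OF L] q uc s by (intro acc_prob_perturb) (auto simp: mult.assoc)
    moreover have "Re ((u - phi True) \<bullet>c (u - phi True)) / s \<le> 2 * ((\<Sum>j<k. w j * acc_prob (kron M (1\<^sub>m r)) (psi False j))
      - (\<Sum>j<k. w j * acc_prob (kron M (1\<^sub>m r)) (psi True j))) / s"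
      using close s by (intro divide_right_mono) auto
    ultimately show "acc_prob (kron L (1\<^sub>m k)) (kron (1\<^sub>m c) (transpose_mat U) *\<^sub>v phi False) \<ge>
       (\<Sum>j<k. w j * acc_prob L (psi True j)) - s
        - 2 * ((\<Sum>j<k. w j * acc_prob (kron M (1\<^sub>m r)) (psi False j))
             - (\<Sum>j<k. w j * acc_prob (kron M (1\<^sub>m r)) (psi True j))) / s"
      using acc[OF povm_elem_carrier[OF L], of True] unfolding u_def by linarith
  qed (use q' U M id acc povm_elem_carrier unitary_mat_transpose in auto)
qed

section \<open>Expectations over nearly independent pairs\<close>

lemma integrable_measure_pmf_bounded:
  fixes f :: "'a \<Rightarrow> real"
  assumes "\<And>x. 0 \<le> f x \<and> f x \<le> 1"
  shows "integrable (measure_pmf p) f"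
  by (rule measure_pmf.integrable_const_bound[where B = 1]) (use assms in auto)

lemma expectation_bounds:
  fixes f :: "'a \<Rightarrow> real"
  assumes "\<And>x. 0 \<le> f x \<and> f x \<le> 1"
  shows "0 \<le> measure_pmf.expectation p f \<and> measure_pmf.expectation p f \<le> 1"
  using measure_pmf.integral_le_const[OF integrable_measure_pmf_bounded[of f p, OF assms], of 1] assms
  by (auto intro!: Bochner_Integration.integral_nonneg)

text \<open>Turns expectations into weighted infinite sums, the form in which the distance between
  distributions is given.\<close>

lemma expectation_has_sum:
  fixes f :: "'a \<Rightarrow> real"
  assumes "\<And>x. 0 \<le> f x \<and> f x \<le> 1"
  shows "((\<lambda>x. pmf p x * f x) has_sum measure_pmf.expectation p f) UNIV"
proof -
  have a: "Infinite_Set_Sum.abs_summable_on (\<lambda>x. pmf p x * f x) UNIV"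
    by (rule abs_summable_on_comparison_test'[OF pmf_abs_summable[of p]])
      (use assms in \<open>auto simp: abs_mult mult_left_le\<close>)
  then have "(\<lambda>x. pmf p x * f x) summable_on UNIV"
    using abs_summable_equivalent abs_summable_summable by blast
  then show ?thesis
    unfolding pmf_expectation_eq_infsetsum infsetsum_infsum[OF a] by (rule has_sum_infsum)
qed

lemma pmf_has_sum: "(pmf p has_sum 1) UNIV"
  using expectation_has_sum[of "\<lambda>_. 1" p] by simp

lemma expectation_pair_pmf:
  fixes f :: "'a \<times> 'b \<Rightarrow> real"
  assumes "\<And>z. 0 \<le> f z \<and> f z \<le> 1"
  shows "measure_pmf.expectation (pair_pmf p q) f =
    measure_pmf.expectation p (\<lambda>x. measure_pmf.expectation q (\<lambda>y. f (x, y)))"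
proof -
  have s: "((\<lambda>z. pmf (pair_pmf p q) z * f z) has_sum measure_pmf.expectation (pair_pmf p q) f) (UNIV \<times> UNIV)"
    using expectation_has_sum[OF assms] by simp
  have "((\<lambda>y. pmf (pair_pmf p q) (x, y) * f (x, y)) has_sum
      pmf p x * measure_pmf.expectation q (\<lambda>y. f (x, y))) UNIV" for x
    using has_sum_cmult_right[OF expectation_has_sum[of "\<lambda>y. f (x, y)" q], of "pmf p x"] assms
    by (simp add: pmf_pair mult.assoc)
  from has_sum_SigmaD[OF s this]
  have "((\<lambda>x. pmf p x * measure_pmf.expectation q (\<lambda>y. f (x, y))) has_sum
      measure_pmf.expectation (pair_pmf p q) f) UNIV" .
  moreover have "((\<lambda>x. pmf p x * measure_pmf.expectation q (\<lambda>y. f (x, y))) has_sum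
      measure_pmf.expectation p (\<lambda>x. measure_pmf.expectation q (\<lambda>y. f (x, y)))) UNIV"
    by (intro expectation_has_sum expectation_bounds assms)
  ultimately show ?thesis by (rule has_sum_unique)
qed

lemma expectation_close:
  fixes f :: "'a \<Rightarrow> real"
  assumes "\<And>x. 0 \<le> f x \<and> f x \<le> 1"
  shows "\<bar>measure_pmf.expectation p f - measure_pmf.expectation q f\<bar> \<le> (\<Sum>\<^sub>\<infinity>x. \<bar>pmf p x - pmf q x\<bar>)"
proof -
  have d: "((\<lambda>x. pmf p x * f x - pmf q x * f x) has_sum
      (measure_pmf.expectation p f - measure_pmf.expectation q f)) UNIV"
    unfolding diff_conv_add_uminus
    by (intro has_sum_add has_sum_uminusI expectation_has_sum assms)
  \<comment> \<open>Comparison with this sum gives convergence of the distance; a divergent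
    \<open>infsum\<close> would take the default value 0.\<close>
  have "(\<lambda>x. pmf p x + pmf q x) summable_on UNIV"
    using has_sum_add[OF pmf_has_sum[of p] pmf_has_sum[of q]] by (rule has_sum_imp_summable)
  then have "(\<lambda>x. \<bar>pmf p x - pmf q x\<bar>) summable_on UNIV"
    by (rule summable_on_comparison_test) (auto simp: abs_if)
  then have s: "((\<lambda>x. \<bar>pmf p x - pmf q x\<bar>) has_sum (\<Sum>\<^sub>\<infinity>x. \<bar>pmf p x - pmf q x\<bar>)) UNIV"
    by simp
  have "norm (pmf p x * f x - pmf q x * f x) \<le> \<bar>pmf p x - pmf q x\<bar>" for x
    using assms[of x] by (simp add: left_diff_distrib[symmetric] abs_mult mult_left_le)
  from norm_infsum_le[OF d s this] show ?thesis by simp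
qed

lemma expectation_diff_le:
  fixes f g :: "'a \<Rightarrow> real"
  assumes "\<And>x. 0 \<le> f x \<and> f x \<le> 1" "\<And>x. 0 \<le> g x \<and> g x \<le> 1" "\<And>x. \<bar>f x - g x\<bar> \<le> e"
  shows "\<bar>measure_pmf.expectation p f - measure_pmf.expectation p g\<bar> \<le> e"
proof -
  note i = integrable_measure_pmf_bounded[of f p, OF assms(1)] integrable_measure_pmf_bounded[of g p, OF assms(2)]
  have "measure_pmf.expectation p f \<le> measure_pmf.expectation p (\<lambda>x. g x + e)"
    using i by (intro integral_mono) (auto, smt (verit) assms(3))
  moreover have "measure_pmf.expectation p g \<le> measure_pmf.expectation p (\<lambda>x. f x + e)"
    using i by (intro integral_mono) (auto, smt (verit) assms(3))
  ultimately show ?thesis using i by simp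
qed

text \<open>Three replacements of \<open>D\<close> by the product distribution, at cost
  \<open>e\<close> each: in the inner expectation, in the outer one, and in the expectation of
  \<open>h\<close>. Under the product, drawing the second component afresh changes nothing.\<close>

lemma independent_resampling:
  fixes h :: "'a \<times> 'b \<Rightarrow> real"
  assumes h: "\<And>z. 0 \<le> h z \<and> h z \<le> 1"
    and e: "(\<Sum>\<^sub>\<infinity>(x, y). \<bar>pmf D (x, y) - pmf E x * pmf F y\<bar>) = e"
  shows "\<bar>measure_pmf.expectation D (\<lambda>z. measure_pmf.expectation D (\<lambda>z'. h (fst z, snd z')))
      - measure_pmf.expectation D h\<bar> \<le> 3 * e"
proof -
  let ?P = "pair_pmf E F"
  have c: "\<bar>measure_pmf.expectation D f - measure_pmf.expectation ?P f\<bar> \<le> e"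
    if "\<And>x. 0 \<le> f x \<and> f x \<le> 1" for f
  proof -
    have "(\<Sum>\<^sub>\<infinity>v. \<bar>pmf D v - pmf ?P v\<bar>) = e"
      unfolding e[symmetric] by (rule infsum_cong) (auto simp: pmf_pair)
    then show ?thesis
      using expectation_close[where p = D and q = ?P and f = f, OF that] by linarith
  qed
  define a where "a x = measure_pmf.expectation D (\<lambda>z'. h (x, snd z'))" for x
  define b where "b x = measure_pmf.expectation ?P (\<lambda>z'. h (x, snd z'))" for x
  have ab: "0 \<le> a x \<and> a x \<le> 1" "0 \<le> b x \<and> b x \<le> 1" for x
    unfolding a_def b_def by (intro expectation_bounds h)+
  have "b x = measure_pmf.expectation F (\<lambda>y. h (x, y))" for x
    unfolding b_def by (rule expectation_pair_pmf_snd)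
  then have "b = (\<lambda>x. measure_pmf.expectation F (\<lambda>y. h (x, y)))" by (rule ext)
  then have "measure_pmf.expectation ?P (\<lambda>z. b (fst z)) = measure_pmf.expectation ?P h"
    unfolding expectation_pair_pmf[of h E F, OF h] expectation_pair_pmf_fst[of E F b] by simp
  moreover have "\<bar>measure_pmf.expectation D (\<lambda>z. a (fst z)) - measure_pmf.expectation D (\<lambda>z. b (fst z))\<bar> \<le> e"
    using ab c h by (intro expectation_diff_le) (auto simp: a_def b_def)
  moreover have "\<bar>measure_pmf.expectation D (\<lambda>z. b (fst z)) - measure_pmf.expectation ?P (\<lambda>z. b (fst z))\<bar> \<le> e"
    by (rule c) (rule ab)
  moreover have "\<bar>measure_pmf.expectation D h - measure_pmf.expectation ?P h\<bar> \<le> e"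
    by (rule c) (rule h)
  ultimately show ?thesis unfolding a_def by linarith
qed

text \<open>A finite set \<open>S\<close> carries all but \<eta> of the mass, and the rest goes to
  one further index. That index and the complement of \<open>S\<close> each contribute between 0 and
  the missing mass, so a single choice of weights serves every \<open>f\<close>. The lower bound
  \<open>m\<close> on \<open>k\<close> later makes the committer's register large enough.\<close>

lemma finite_approx_pmf:
  fixes p :: "'a pmf"
  assumes "\<eta> > 0"
  shows "\<exists>k (w :: nat \<Rightarrow> real) z. m \<le> k \<and> (\<forall>j. w j \<ge> 0) \<and> (\<Sum>j<k. w j) = 1 \<and>
    (\<forall>f. (\<forall>x. 0 \<le> f x \<and> f x \<le> 1) \<longrightarrow> \<bar>(\<Sum>j<k. w j * f (z j)) - measure_pmf.expectation p f\<bar> \<le> \<eta>)"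
proof -
  obtain S where S: "finite S" "dist (sum (pmf p) S) 1 \<le> \<eta>"
    using has_sum_finite_approximation[OF pmf_has_sum[of p] \<open>\<eta> > 0\<close>] by auto
  define n where "n = card S"
  obtain z where z: "bij_betw z {..<n} S"
    using ex_bij_betw_nat_finite[OF S(1)] unfolding n_def by (auto simp: atLeast0LessThan)
  have PS: "sum (pmf p) S = measure (measure_pmf p) S" using S(1) by (simp add: measure_measure_pmf_finite)
  then have r: "1 - sum (pmf p) S \<ge> 0" "1 - sum (pmf p) S \<le> \<eta>"
    using S(2) by (auto simp: dist_real_def)
  \<comment> \<open>Index \<open>n\<close> takes the missing mass, at the unspecified point
    \<open>z n\<close>; the remaining \<open>m\<close> indices are padding of weight 0.\<close>
  define k where "k = Suc n + m"
  define w where "w j = (if j < n then pmf p (z j) else if j = n then 1 - sum (pmf p) S else 0)" for j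
  have ws: "(\<Sum>j<k. w j * g j) = (\<Sum>j<n. pmf p (z j) * g j) + (1 - sum (pmf p) S) * g n" for g
  proof -
    have "(\<Sum>j<k. w j * g j) = (\<Sum>j<Suc n. w j * g j)"
      by (rule sum.mono_neutral_right) (auto simp: k_def w_def)
    then show ?thesis by (simp add: w_def)
  qed
  have zs: "(\<Sum>j<n. pmf p (z j) * f (z j)) = (\<Sum>x\<in>S. pmf p x * f x)" for f
    by (rule sum.reindex_bij_betw[OF z])
  have "(\<Sum>j<k. w j) = 1" using ws[of "\<lambda>_. 1"] zs[of "\<lambda>_. 1"] by simp
  moreover have "\<bar>(\<Sum>j<k. w j * f (z j)) - measure_pmf.expectation p f\<bar> \<le> \<eta>"
    if f: "\<forall>x. 0 \<le> f x \<and> f x \<le> 1" for f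
  proof -
    have i: "integrable (measure_pmf p) (\<lambda>x. f x * indicator S x)" "integrable (measure_pmf p) (\<lambda>x. f x * indicator (- S) x)"
      using f by (auto intro!: integrable_measure_pmf_bounded simp: indicator_def)
    have "measure_pmf.expectation p f =
        measure_pmf.expectation p (\<lambda>x. f x * indicator S x + f x * indicator (- S) x)"
      by (rule arg_cong[where f = "measure_pmf.expectation p"]) (auto simp: indicator_def)
    also have "\<dots> = measure_pmf.expectation p (\<lambda>x. f x * indicator S x)
        + measure_pmf.expectation p (\<lambda>x. f x * indicator (- S) x)"
      using i by simp
    also have "measure_pmf.expectation p (\<lambda>x. f x * indicator S x) = (\<Sum>x\<in>S. pmf p x * f x)"
      using S(1) by (subst integral_measure_pmf_real[of S]) (auto simp: indicator_def mult.commute split: if_splits)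
    finally have 1: "measure_pmf.expectation p f = (\<Sum>x\<in>S. pmf p x * f x)
        + measure_pmf.expectation p (\<lambda>x. f x * indicator (- S) x)" .
    have "measure_pmf.expectation p (\<lambda>x. f x * indicator (- S) x) \<le> measure_pmf.expectation p (\<lambda>x. indicator (- S) x)"
      using f i by (intro integral_mono) (auto simp: indicator_def intro!: integrable_measure_pmf_bounded)
    also have "\<dots> = 1 - sum (pmf p) S"
      using PS measure_pmf.prob_compl[of S p] by (simp add: Compl_eq_Diff_UNIV)
    finally have "measure_pmf.expectation p (\<lambda>x. f x * indicator (- S) x) \<le> 1 - sum (pmf p) S" .
    moreover have "0 \<le> measure_pmf.expectation p (\<lambda>x. f x * indicator (- S) x)"
      using f by (intro Bochner_Integration.integral_nonneg) (auto simp: indicator_def)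
    moreover have "0 \<le> (1 - sum (pmf p) S) * f (z n)" "(1 - sum (pmf p) S) * f (z n) \<le> 1 - sum (pmf p) S"
      using f r by (auto intro: mult_left_le)
    ultimately show ?thesis
      using r unfolding ws[of "\<lambda>j. f (z j)"] zs 1 by linarith
  qed
  moreover have "w j \<ge> 0" for j using r by (simp add: w_def)
  ultimately show ?thesis
    by (intro exI[of _ k] exI[of _ w] exI[of _ z]) (auto simp: k_def)
qed

section \<open>Impossibility of the commitment scheme\<close>

theorem theoremA8:
  fixes D :: "nat \<Rightarrow> (bool list \<times> bool list) pmf"
    and E :: "nat \<Rightarrow> bool list pmf"
    and F :: "nat \<Rightarrow> bool list pmf"
  assumes close: "\<And>n. (\<Sum>\<^sub>\<infinity>(x, y). \<bar>pmf (D n) (x, y) - pmf (E n) x * pmf (F n) y\<bar>)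
                        < (5 - 2 * sqrt 2) / 17"
  shows "\<not> (\<exists>dC dR Psi Lam.
             wf_scheme dC dR Psi Lam \<and>
             correct_scheme D Psi Lam \<and>
             stat_hiding D dC dR Psi \<and>
             stat_sum_binding D dC dR Lam)"
proof
  assume "\<exists>dC dR Psi Lam. wf_scheme dC dR Psi Lam \<and> correct_scheme D Psi Lam \<and>
             stat_hiding D dC dR Psi \<and> stat_sum_binding D dC dR Lam"
  then obtain dC dR Psi Lam where wf: "wf_scheme dC dR Psi Lam"
    and corr: "correct_scheme D Psi Lam"
    and hid: "stat_hiding D dC dR Psi"
    and bind: "stat_sum_binding D dC dR Lam" by blast
  have psi: "qstate (dC n * dR n) (Psi n x b)" and lam: "povm_elem (dC n * dR n) (Lam n y b)" for n x y b
    using wf by (auto simp: wf_scheme_def)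
  \<comment> \<open>Any small slack works: the final inequality has room for more than 0.15.\<close>
  define \<eta> :: real where "\<eta> = 1 / 10000"
  define approx where "approx n k w z \<longleftrightarrow> dC n \<le> k \<and> (\<forall>j. w j \<ge> 0) \<and> (\<Sum>j<k. w j) = 1 \<and>
    (\<forall>f. (\<forall>x. 0 \<le> f x \<and> f x \<le> 1) \<longrightarrow>
      \<bar>(\<Sum>j<k. w j * f (z j)) - measure_pmf.expectation (map_pmf fst (D n)) f\<bar> \<le> \<eta>)"
    for n k and w :: "nat \<Rightarrow> real" and z :: "nat \<Rightarrow> bool list"
  have "\<forall>n. \<exists>k w z. approx n k w z"
    unfolding approx_def by (intro allI finite_approx_pmf) (simp add: \<eta>_def)
  \<comment> \<open>Binding quantifies over strategies for all security parameters at once, so the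
    choices are made as functions of \<open>n\<close>.\<close>
  then have "\<exists>k w z. \<forall>n. approx n (k n) (w n) (z n)" by (simp only: choice_iff)
  then obtain k w z where "\<And>n. approx n (k n) (w n) (z n)" by blast
  then have dCk: "dC n \<le> k n" and w: "\<And>j. w n j \<ge> 0" "(\<Sum>j<k n. w n j) = 1"
    and app: "\<And>f. (\<And>x. 0 \<le> f x \<and> f x \<le> 1) \<Longrightarrow>
      \<bar>(\<Sum>j<k n. w n j * f (z n j)) - measure_pmf.expectation (D n) (\<lambda>v. f (fst v))\<bar> \<le> \<eta>" for n
    by (simp_all add: approx_def)
  define attack where "attack n phi U M \<longleftrightarrow>
    qstate (dC n * (dR n * k n)) phi \<and> unitary_mat (dR n * k n) U \<and> povm_elem (dC n) M \<and>
    (\<forall>L. povm_elem (dC n * dR n) L \<longrightarrow>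
      acc_prob (kron L (1\<^sub>m (k n))) (kron (1\<^sub>m (dC n)) (1\<^sub>m (dR n * k n)) *\<^sub>v phi) =
        (\<Sum>j<k n. w n j * acc_prob L (Psi n (z n j) False))) \<and>
    (\<forall>L s. povm_elem (dC n * dR n) L \<longrightarrow> s > 0 \<longrightarrow>
      acc_prob (kron L (1\<^sub>m (k n))) (kron (1\<^sub>m (dC n)) U *\<^sub>v phi) \<ge>
        (\<Sum>j<k n. w n j * acc_prob L (Psi n (z n j) True)) - s
        - 2 * ((\<Sum>j<k n. w n j * acc_prob (kron M (1\<^sub>m (dR n))) (Psi n (z n j) False))
             - (\<Sum>j<k n. w n j * acc_prob (kron M (1\<^sub>m (dR n))) (Psi n (z n j) True))) / s)"
    for n phi U M
  have "\<forall>n. \<exists>phi U M. attack n phi U M"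
    unfolding attack_def
    by (rule allI, rule bit_flip_attack)
      (use psi w dCk in auto)
  then have "\<exists>phi U M. \<forall>n. attack n (phi n) (U n) (M n)" by (simp only: choice_iff)
  then obtain phi U M where "\<And>n. attack n (phi n) (U n) (M n)" by blast
  then have phi: "qstate (dC n * (dR n * k n)) (phi n)"
    and U: "unitary_mat (dR n * k n) (U n)" and M: "povm_elem (dC n) (M n)"
    and honest: "povm_elem (dC n * dR n) L \<Longrightarrow>
      acc_prob (kron L (1\<^sub>m (k n))) (kron (1\<^sub>m (dC n)) (1\<^sub>m (dR n * k n)) *\<^sub>v phi n) =
        (\<Sum>j<k n. w n j * acc_prob L (Psi n (z n j) False))"
    and flipped: "povm_elem (dC n * dR n) L \<Longrightarrow> s > 0 \<Longrightarrow>
      acc_prob (kron L (1\<^sub>m (k n))) (kron (1\<^sub>m (dC n)) (U n) *\<^sub>v phi n) \<ge>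
        (\<Sum>j<k n. w n j * acc_prob L (Psi n (z n j) True)) - s
        - 2 * ((\<Sum>j<k n. w n j * acc_prob (kron (M n) (1\<^sub>m (dR n))) (Psi n (z n j) False))
             - (\<Sum>j<k n. w n j * acc_prob (kron (M n) (1\<^sub>m (dR n))) (Psi n (z n j) True))) / s"
    for n L s
    unfolding attack_def by blast+
  \<comment> \<open>The strategy ignores \<open>x\<close>: \<open>False\<close> is opened by the
    identity and \<open>True\<close> by \<open>U n\<close>. The private register E has dimension
    \<open>k n\<close> and holds the index \<open>j\<close>.\<close>
  define V where "V n b (x :: bool list) = (if b then U n else 1\<^sub>m (dR n * k n))" for n b x
  let ?p = "\<lambda>n b. binding_prob D dC Lam k (\<lambda>n x. phi n) V n b"
  have "negligible (\<lambda>n. max 0 (?p n False + ?p n True - 1))"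
    using bind phi U unfolding stat_sum_binding_def by (simp add: V_def unitary_mat_one)
  then obtain N1 where N1: "\<And>n. n \<ge> N1 \<Longrightarrow> \<bar>max 0 (?p n False + ?p n True - 1)\<bar> \<le> 1 / real n ^ 1"
    unfolding negligible_def by meson
  \<comment> \<open>The test \<open>M n\<close>, taken for every \<open>y\<close>, is a hiding
    adversary, so its advantage is negligible.\<close>
  let ?q = "\<lambda>n b. hiding_adv D dR Psi (\<lambda>n y. M n) n b"
  have "negligible (\<lambda>n. \<bar>?q n False - ?q n True\<bar>)"
    using hid M unfolding stat_hiding_def by simp
  then obtain N2 where N2: "\<And>n. n \<ge> N2 \<Longrightarrow> \<bar>\<bar>?q n False - ?q n True\<bar>\<bar> \<le> 1 / real n ^ 1"
    unfolding negligible_def by meson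
  \<comment> \<open>Beyond both thresholds, and large enough that the bound 1/n from exponent 1 is
    at most 1/10000.\<close>
  define n where "n = N1 + N2 + 10000"
  have nN: "n \<ge> N1" "n \<ge> N2" by (simp_all add: n_def)
  have small: "1 / real n \<le> 1 / 10000" by (simp add: n_def)
  have bound: "?p n False + ?p n True - 1 \<le> 1 / 10000"
    using N1[OF nN(1)] small unfolding power_one_right by linarith
  have hide: "\<bar>?q n False - ?q n True\<bar> \<le> 1 / 10000"
    using N2[OF nN(2)] small unfolding power_one_right by linarith
  define \<epsilon> where "\<epsilon> = (\<Sum>\<^sub>\<infinity>(x, y). \<bar>pmf (D n) (x, y) - pmf (E n) x * pmf (F n) y\<bar>)"
  \<comment> \<open>Then (5 - 2 sqrt 2)/17 is at most 2.2/17, which is below 0.13.\<close>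
  have "sqrt 2 \<ge> 1.4" by (rule real_le_rsqrt) (simp add: power2_eq_square)
  then have eps: "\<epsilon> < 13 / 100"
    using close[of n] by (simp add: \<epsilon>_def field_simps)
  define g where "g b v = acc_prob (Lam n (snd v) b) (Psi n (fst v) b)" for b v
  have g: "0 \<le> g b v \<and> g b v \<le> 1" for b v
    unfolding g_def using psi[of n] lam[of n] acc_prob_nonneg acc_prob_le_one
    by (meson qstate_def)
  have Eg: "measure_pmf.expectation (D n) (g b) = 1" for b
  proof -
    have "measure_pmf.expectation (D n) (g b) = measure_pmf.expectation (D n) (\<lambda>_. 1)"
      using corr by (intro integral_cong_AE) (auto simp: AE_measure_pmf_iff g_def correct_scheme_def)
    then show ?thesis by simp
  qed
  \<comment> \<open>Correctness gives 1 on pairs drawn jointly; resampling the first component costs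
    3\<epsilon>, and replacing its marginal by the finite mixture costs \<eta>.\<close>
  have mix: "measure_pmf.expectation (D n) (\<lambda>v. \<Sum>j<k n. w n j * g b (z n j, snd v)) \<ge> 1 - 3 * \<epsilon> - \<eta>" for b
  proof -
    define G where "G x = measure_pmf.expectation (D n) (\<lambda>v. g b (x, snd v))" for x
    have G: "0 \<le> G x \<and> G x \<le> 1" for x
      unfolding G_def by (rule expectation_bounds) (rule g)
    have "measure_pmf.expectation (D n) (\<lambda>v. \<Sum>j<k n. w n j * g b (z n j, snd v)) =
        (\<Sum>j<k n. w n j * G (z n j))"
      unfolding G_def using g
      by (subst Bochner_Integration.integral_sum) (auto intro!: integrable_mult_right integrable_measure_pmf_bounded)
    moreover have "\<bar>measure_pmf.expectation (D n) (\<lambda>v. G (fst v)) - measure_pmf.expectation (D n) (g b)\<bar> \<le> 3 * \<epsilon>"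
      unfolding G_def by (rule independent_resampling[of "g b"]) (use g in \<open>auto simp: \<epsilon>_def\<close>)
    ultimately show ?thesis using app[of G n, OF G] Eg[of b] by linarith
  qed
  have p0: "?p n False \<ge> 1 - 3 * \<epsilon> - \<eta>"
    using mix[of False] honest[OF lam, of n]
    by (simp add: binding_prob_def V_def g_def case_prod_unfold)
  define m where "m b x = acc_prob (kron (M n) (1\<^sub>m (dR n))) (Psi n x b)" for b x
  have mb: "0 \<le> m b x \<and> m b x \<le> 1" for b x
    unfolding m_def using psi[of n] povm_elem_kron_one[OF M[of n]] acc_prob_nonneg acc_prob_le_one
    by (meson qstate_def)
  have q: "?q n b = measure_pmf.expectation (D n) (\<lambda>v. m b (fst v))" for b
    by (simp add: hiding_adv_def m_def case_prod_unfold)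
  define \<tau> where "\<tau> = (\<Sum>j<k n. w n j * m False (z n j)) - (\<Sum>j<k n. w n j * m True (z n j))"
  \<comment> \<open>The hiding gap of 1/10000 plus \<eta> for each of the two bits.\<close>
  have tau: "\<tau> \<le> 3 / 10000"
    using app[of "m False" n, OF mb] app[of "m True" n, OF mb] hide
    unfolding q \<tau>_def \<eta>_def by linarith
  define h where "h v = acc_prob (kron (Lam n (snd v) True) (1\<^sub>m (k n))) (kron (1\<^sub>m (dC n)) (U n) *\<^sub>v phi n)"
    for v :: "bool list \<times> bool list"
  \<comment> \<open>With \<open>s = 1 / 20\<close> the perturbation loss
    \<open>s + 2 * \<tau> / s\<close> is \<open>1 / 20 + 40 * \<tau>\<close>.\<close>
  have hl: "(\<Sum>j<k n. w n j * g True (z n j, snd v)) - (1 / 20 + 40 * \<tau>) \<le> h v" for v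
    using flipped[OF lam, of "1 / 20" n "snd v" True]
    unfolding h_def g_def \<tau>_def m_def by simp
  \<comment> \<open>The squared norm of the opened state bounds \<open>h\<close> by a constant
    independent of \<open>v\<close>.\<close>
  have hi: "integrable (measure_pmf (D n)) h"
  proof (rule measure_pmf.integrable_const_bound)
    let ?v = "kron (1\<^sub>m (dC n)) (U n) *\<^sub>v phi n"
    have vc: "?v \<in> carrier_vec (dC n * dR n * k n)"
      using unitary_mat_carrier[OF U[of n]] by (simp add: carrier_vecI mult.assoc)
    show "AE v in measure_pmf (D n). norm (h v) \<le> Re (?v \<bullet>c ?v)"
      using acc_prob_nonneg[OF povm_elem_kron_one[OF lam] vc] acc_prob_le_norm[OF povm_elem_kron_one[OF lam] vc]
      by (simp add: h_def)
  qed simp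
  have wg: "0 \<le> (\<Sum>j<k n. w n j * g b (z n j, y)) \<and> (\<Sum>j<k n. w n j * g b (z n j, y)) \<le> 1" for b y
  proof
    show "0 \<le> (\<Sum>j<k n. w n j * g b (z n j, y))"
      using w g by (intro sum_nonneg) auto
    have "(\<Sum>j<k n. w n j * g b (z n j, y)) \<le> (\<Sum>j<k n. w n j)"
      using w g by (intro sum_mono) (auto intro: mult_left_le)
    then show "(\<Sum>j<k n. w n j * g b (z n j, y)) \<le> 1" using w by simp
  qed
  have gi: "integrable (measure_pmf (D n)) (\<lambda>v. \<Sum>j<k n. w n j * g True (z n j, snd v))"
    by (rule integrable_measure_pmf_bounded) (rule wg)
  have "measure_pmf.expectation (D n) (\<lambda>v. (\<Sum>j<k n. w n j * g True (z n j, snd v)) - (1 / 20 + 40 * \<tau>))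
      \<le> measure_pmf.expectation (D n) h"
    by (rule integral_mono) (use gi hi hl in auto)
  moreover have "measure_pmf.expectation (D n) (\<lambda>v. (\<Sum>j<k n. w n j * g True (z n j, snd v)) - (1 / 20 + 40 * \<tau>))
      = measure_pmf.expectation (D n) (\<lambda>v. \<Sum>j<k n. w n j * g True (z n j, snd v)) - (1 / 20 + 40 * \<tau>)"
    using gi by simp
  moreover have "measure_pmf.expectation (D n) h = ?p n True"
    by (simp add: binding_prob_def V_def h_def[abs_def] case_prod_unfold)
  ultimately have p1: "?p n True \<ge> 1 - 3 * \<epsilon> - \<eta> - (1 / 20 + 40 * \<tau>)"
    using mix[of True] by linarith
  \<comment> \<open>The sum of both probabilities is at least 2 - 6\<epsilon> - 2\<eta> - 1/20 -
    40\<tau>, which exceeds 2 - 0.78 - 0.0002 - 0.05 - 0.012 > 1.15, against the bound 1.0001 from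
    binding.\<close>
  show False
    using p0 p1 tau eps bound unfolding \<eta>_def by linarith
qed

end
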